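(* Let $K\ge 2$. For $n\ge K$ let $\tilde C^{(n)}_K$ be the copula of the $K$ largest order statistics of an iid sample of size $n$ with continuous parent distribution, and let $C_K$ be the $K$-extremal copula. Then $\tilde C^{(n)}_K$ converges in distribution to $C_K$ as $n\to\infty$.
   Context: For an iid sample of size $n\ge K$ from a distribution with continuous distribution function $F$, let $M_{1,n}\ge M_{2,n}\ge\dots\ge M_{K,n}$ be its $K$ largest order statistics and $F_{j,n}$ the distribution function of $M_{j,n}$. The copula $\tilde C^{(n)}_K$ of $(M_{1,n},\dots,M_{K,n})$ is the joint distribution function of $(F_{1,n}(M_{1,n}),\dots,F_{K,n}(M_{K,n}))$; it does not depend on the choice of the continuous $F$ (a known fact). For parameters $\mu\in\mathbb{R}$, $\sigma>0$, $\xi\in\mathbb{R}$ define $$\Lambda(z)=\Big[1+\xi\,\tfrac{z-\mu}{\sigma}\Big]^{-1/\xi}\ \text{ if }\xi\ne 0 \text{ and } \xi\,\tfrac{z-\mu}{\sigma}>-1,\qquad \Lambda(z)=\exp\big(-\tfrac{z-\mu}{\sigma}\big)\ \text{ if }\xi=0,\ z\in\mathbb{R}.$$ The $K$-dimensional Multivariate Generalized Extreme Value (MGEV) distribution with parameters $(\mu,\sigma,\xi)$ is the probability distribution on $\mathbb{R}^K$ with density $$\tilde g_K(z_1,\dots,z_K)=(-1)^K\exp\{-\Lambda(z_K)\}\prod_{j=1}^K\Lambda'(z_j)\ \text{ if }(z_1,\dots,z_K)\in\Omega_\xi,$$ and $\tilde g_K=0$ otherwise, where $\Omega_0=\{z_1>\dots>z_K\}$,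 $\Omega_\xi=\{z_1>\dots>z_K>\mu-\frac{\sigma}{\xi}\}$ for $\xi>0$, and $\Omega_\xi=\{\mu-\frac{\sigma}{\xi}>z_1>\dots>z_K\}$ for $\xi<0$. The $K$-extremal copula $C_K$ is the copula of the $K$-dimensional MGEV distribution, which does not depend on $(\mu,\sigma,\xi)$. Convergence in distribution of copulas means weak convergence of the corresponding probability measures on $[0,1]^K$. *)

theory Defs
  imports "HOL-Probability.Probability"
begin

text \<open>
  Points of \<open>\<real>^K\<close> are elements of the space of \<open>PiM {1..K} (\<lambda>_. borel)\<close>, i.e. extensional
  functions on \<open>{1..K}\<close>; their topology is the one they inherit from the product topology on
  \<^typ>\<open>nat \<Rightarrow> real\<close>.
\<close>

definition unit_cube :: "nat \<Rightarrow> (nat \<Rightarrow> real) measure" where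
  "unit_cube K = PiM {1..K} (\<lambda>_. restrict_space borel {0..1})"

definition copula :: "nat \<Rightarrow> 'a measure \<Rightarrow> (nat \<Rightarrow> 'a \<Rightarrow> real) \<Rightarrow> (nat \<Rightarrow> real) \<Rightarrow> real" where
  "copula K M Y u =
     measure M {\<omega> \<in> space M. \<forall>j\<in>{1..K}. cdf (distr M borel (Y j)) (Y j \<omega>) \<le> u j}"

definition has_joint_df :: "nat \<Rightarrow> (nat \<Rightarrow> real) measure \<Rightarrow> ((nat \<Rightarrow> real) \<Rightarrow> real) \<Rightarrow> bool" where
  "has_joint_df K Q C \<longleftrightarrow>
     prob_space Q \<and> sets Q = sets (unit_cube K) \<and>
     (\<forall>u. measure Q {x \<in> space Q. \<forall>j\<in>{1..K}. x j \<le> u j} = C u)"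

text \<open>
  The probability measure on \<open>[0,1]^K\<close> with distribution function \<open>C\<close>. It is unique if it
  exists, and for the copula of a random vector it exists; both facts are proved below.
\<close>
definition copula_measure :: "nat \<Rightarrow> ((nat \<Rightarrow> real) \<Rightarrow> real) \<Rightarrow> (nat \<Rightarrow> real) measure" where
  "copula_measure K C = (THE Q. has_joint_df K Q C)"

text \<open>The cube is compact, so its continuous functions are automatically bounded.\<close>
definition weak_conv_cube ::
    "nat \<Rightarrow> (nat \<Rightarrow> (nat \<Rightarrow> real) measure) \<Rightarrow> (nat \<Rightarrow> real) measure \<Rightarrow> bool" where
  "weak_conv_cube K Q R \<longleftrightarrow>
     (\<forall>f :: (nat \<Rightarrow> real) \<Rightarrow> real. continuous_on (PiE {1..K} (\<lambda>_. {0..1})) f \<longrightarrow>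
        (\<lambda>n. integral\<^sup>L (Q n) f) \<longlonglongrightarrow> integral\<^sup>L R f)"

definition copula_conv_in_distribution ::
    "nat \<Rightarrow> (nat \<Rightarrow> (nat \<Rightarrow> real) \<Rightarrow> real) \<Rightarrow> ((nat \<Rightarrow> real) \<Rightarrow> real) \<Rightarrow> bool" where
  "copula_conv_in_distribution K C D \<longleftrightarrow>
     weak_conv_cube K (\<lambda>n. copula_measure K (C n)) (copula_measure K D)"

text \<open>The \<open>j\<close>-th largest, counted with multiplicity, of \<open>x 1, \<dots>, x n\<close>, for \<open>1 \<le> j \<le> n\<close>.\<close>
definition kth_largest :: "nat \<Rightarrow> nat \<Rightarrow> (nat \<Rightarrow> real) \<Rightarrow> real" where
  "kth_largest n j x = rev (sort (map x [1..<Suc n])) ! (j - 1)"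

text \<open>The value 0 outside the domain of \<open>\<Lambda>\<close> is a dummy: the density only evaluates
  \<open>\<Lambda>\<close> and its derivative inside that domain, which is open.\<close>
definition mgev_Lambda :: "real \<Rightarrow> real \<Rightarrow> real \<Rightarrow> real \<Rightarrow> real" where
  "mgev_Lambda \<mu> \<sigma> \<xi> z =
     (if \<xi> = 0 then exp (- ((z - \<mu>) / \<sigma>))
      else if \<xi> * ((z - \<mu>) / \<sigma>) > -1 then (1 + \<xi> * ((z - \<mu>) / \<sigma>)) powr (- 1 / \<xi>)
      else 0)"

definition mgev_support :: "nat \<Rightarrow> real \<Rightarrow> real \<Rightarrow> real \<Rightarrow> (nat \<Rightarrow> real) set" where
  "mgev_support K \<mu> \<sigma> \<xi> =
     {z. (\<forall>i\<in>{1..K}. \<forall>j\<in>{1..K}. i < j \<longrightarrow> z i > z j) \<and>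
         (\<xi> > 0 \<longrightarrow> z K > \<mu> - \<sigma> / \<xi>) \<and> (\<xi> < 0 \<longrightarrow> \<mu> - \<sigma> / \<xi> > z 1)}"

definition mgev_density :: "nat \<Rightarrow> real \<Rightarrow> real \<Rightarrow> real \<Rightarrow> (nat \<Rightarrow> real) \<Rightarrow> real" where
  "mgev_density K \<mu> \<sigma> \<xi> z =
     (if z \<in> mgev_support K \<mu> \<sigma> \<xi>
      then (-1) ^ K * exp (- mgev_Lambda \<mu> \<sigma> \<xi> (z K)) * (\<Prod>j\<in>{1..K}. deriv (mgev_Lambda \<mu> \<sigma> \<xi>) (z j))
      else 0)"

definition mgev :: "nat \<Rightarrow> real \<Rightarrow> real \<Rightarrow> real \<Rightarrow> (nat \<Rightarrow> real) measure" where
  "mgev K \<mu> \<sigma> \<xi> = density (PiM {1..K} (\<lambda>_. lborel)) (\<lambda>z. ennreal (mgev_density K \<mu> \<sigma> \<xi> z))"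

definition extremal_copula :: "nat \<Rightarrow> real \<Rightarrow> real \<Rightarrow> real \<Rightarrow> (nat \<Rightarrow> real) \<Rightarrow> real" where
  "extremal_copula K \<mu> \<sigma> \<xi> = copula K (mgev K \<mu> \<sigma> \<xi>) (\<lambda>j z. z j)"

lemma space_unit_cube: "space (unit_cube K) = PiE {1..K} (\<lambda>_. {0..1})"
  by (simp add: unit_cube_def space_PiM space_restrict_space)

lemma measurable_unit_cube_component:
  assumes "i \<in> {1..K}"
  shows "(\<lambda>x. x i) \<in> borel_measurable (unit_cube K)"
  unfolding unit_cube_def
  using measurable_component_singleton[OF assms, of "\<lambda>_. restrict_space borel {0..1::real}"]
  by (simp add: measurable_restrict_space2_iff)

lemma sets_unit_cube_lower_box:
  "{x \<in> space (unit_cube K). \<forall>j\<in>{1..K}. x j \<le> u j} \<in> sets (unit_cube K)"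
proof (rule sets.sets_Collect_finite_All)
  fix j assume "j \<in> {1..K}"
  then show "{x \<in> space (unit_cube K). x j \<le> u j} \<in> sets (unit_cube K)"
    using measurable_unit_cube_component[of j K] by (simp add: borel_measurable_iff_le)
qed simp

lemma has_joint_df_unique:
  assumes "has_joint_df K Q C" and "has_joint_df K R C"
  shows "Q = R"
proof -
  define \<Omega> where "\<Omega> = space (unit_cube K)"
  define B where "B u = {x \<in> \<Omega>. \<forall>j\<in>{1..K}. x j \<le> u j}" for u
  define S where "S = sigma \<Omega> (range B)"
  interpret Q: prob_space Q using assms(1) by (simp add: has_joint_df_def)
  interpret R: prob_space R using assms(2) by (simp add: has_joint_df_def)
  have sets: "sets Q = sets (unit_cube K)" "sets R = sets (unit_cube K)"
    using assms by (simp_all add: has_joint_df_def)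
  have sp: "space Q = \<Omega>" "space R = \<Omega>"
    unfolding \<Omega>_def by (rule sets_eq_imp_space_eq, rule sets)+
  have \<Omega>_iff: "x \<in> \<Omega> \<longleftrightarrow> x \<in> PiE {1..K} (\<lambda>_. {0..1})" for x
    by (simp add: \<Omega>_def space_unit_cube)
  have \<Omega>_le: "x i \<le> 1" "0 \<le> x i" if "x \<in> \<Omega>" "i \<in> {1..K}" for x i
    using that PiE_mem[of x "{1..K}" "\<lambda>_. {0..1}" i] unfolding \<Omega>_iff by auto
  have EP: "range B \<subseteq> Pow \<Omega>" by (auto simp: B_def)
  have spS: "space S = \<Omega>" and seS: "sets S = sigma_sets \<Omega> (range B)"
    using EP by (simp_all add: S_def)
  have "(\<lambda>x. x) \<in> measurable S (unit_cube K)"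
    unfolding unit_cube_def
  proof (rule measurable_PiM_single')
    fix i assume i: "i \<in> {1..K}"
    have "{x \<in> \<Omega>. x i \<le> a} \<in> sets S" for a
    proof -
      have "{x \<in> \<Omega>. x i \<le> a} = B (\<lambda>j. if j = i then a else 1)"
        unfolding B_def using i \<Omega>_le by (intro Collect_cong) (auto split: if_splits)
      then show ?thesis unfolding seS by (simp add: sigma_sets.Basic)
    qed
    then have "(\<lambda>x. x i) \<in> borel_measurable S"
      by (simp add: borel_measurable_iff_le spS)
    moreover have "(\<lambda>x. x i) \<in> space S \<rightarrow> {0..1}"
      using i \<Omega>_le by (simp add: spS Pi_def)
    ultimately show "(\<lambda>x. x i) \<in> measurable S (restrict_space borel {0..1})"
      by (simp add: measurable_restrict_space2_iff)
  next
    show "(\<lambda>x i. x i) \<in> space S \<rightarrow> (\<Pi>\<^sub>E i\<in>{1..K}. space (restrict_space borel {0..1}))"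
      by (simp add: spS \<Omega>_def space_unit_cube space_restrict_space)
  qed
  then have "A \<in> sigma_sets \<Omega> (range B)" if "A \<in> sets (unit_cube K)" for A
    using measurable_sets[of "\<lambda>x. x" S "unit_cube K" A] that sets.sets_into_space[OF that]
    by (simp add: spS seS \<Omega>_def Int_absorb2)
  moreover have "sigma_sets \<Omega> (range B) \<subseteq> sets (unit_cube K)"
    unfolding \<Omega>_def
    by (rule sets.sigma_sets_subset) (use sets_unit_cube_lower_box in \<open>auto simp: B_def \<Omega>_def\<close>)
  ultimately have gen: "sets (unit_cube K) = sigma_sets \<Omega> (range B)" by blast
  have top: "B (\<lambda>_. 1) = \<Omega>"
    using \<Omega>_le by (auto simp: B_def)
  show ?thesis
  proof (rule measure_eqI_generator_eq[OF _ EP])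
    show "Int_stable (range B)"
    proof (rule Int_stableI_image)
      fix u v
      have "B u \<inter> B v = B (\<lambda>j. min (u j) (v j))" by (auto simp: B_def)
      then show "\<exists>k\<in>UNIV. B u \<inter> B v = B k" by blast
    qed
    show "emeasure Q X = emeasure R X" if X: "X \<in> range B" for X
    proof -
      obtain u where u: "X = B u" using X by blast
      have "measure Q (B u) = C u" "measure R (B u) = C u"
        using assms by (simp_all add: has_joint_df_def sp B_def)
      then show ?thesis by (simp add: u Q.emeasure_eq_measure R.emeasure_eq_measure)
    qed
    show "sets Q = sigma_sets \<Omega> (range B)" "sets R = sigma_sets \<Omega> (range B)"
      using sets gen by simp_all
    show "range (\<lambda>_::nat. B (\<lambda>_. 1)) \<subseteq> range B" by blast
    show "(\<Union>i::nat. B (\<lambda>_. 1)) = \<Omega>" by (simp add: top)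
    show "emeasure Q (B (\<lambda>_. 1)) \<noteq> \<infinity>" by simp
  qed
qed

lemma copula_measure_eqI: "has_joint_df K Q C \<Longrightarrow> copula_measure K C = Q"
  unfolding copula_measure_def by (blast intro: the_equality has_joint_df_unique)

lemma copula_measure_copula:
  assumes "prob_space M" and Y: "\<And>j. j \<in> {1..K} \<Longrightarrow> Y j \<in> borel_measurable M"
  shows "copula_measure K (copula K M Y) =
    distr M (unit_cube K) (\<lambda>\<omega>. \<lambda>j\<in>{1..K}. cdf (distr M borel (Y j)) (Y j \<omega>))"
    (is "_ = distr M _ ?T")
    and "has_joint_df K (copula_measure K (copula K M Y)) (copula K M Y)"
proof -
  interpret prob_space M by fact
  have T: "?T \<in> measurable M (unit_cube K)"
    unfolding unit_cube_def
  proof (rule measurable_restrict)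
    fix j assume j: "j \<in> {1..K}"
    interpret D: real_distribution "distr M borel (Y j)"
      using Y[OF j] by (rule real_distribution_distr)
    have "cdf (distr M borel (Y j)) \<in> borel_measurable borel"
      by (intro borel_measurable_mono monoI D.cdf_nondecreasing)
    then have "(\<lambda>\<omega>. cdf (distr M borel (Y j)) (Y j \<omega>)) \<in> borel_measurable M"
      using Y[OF j] by (rule measurable_compose[rotated])
    then show "(\<lambda>\<omega>. cdf (distr M borel (Y j)) (Y j \<omega>)) \<in> measurable M (restrict_space borel {0..1})"
      using D.cdf_nonneg D.cdf_bounded_prob by (intro measurable_restrict_space2) auto
  qed
  have "measure (distr M (unit_cube K) ?T)
          {x \<in> space (distr M (unit_cube K) ?T). \<forall>j\<in>{1..K}. x j \<le> u j} = copula K M Y u" for u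
  proof -
    have "?T -` {x \<in> space (unit_cube K). \<forall>j\<in>{1..K}. x j \<le> u j} \<inter> space M =
        {\<omega> \<in> space M. \<forall>j\<in>{1..K}. cdf (distr M borel (Y j)) (Y j \<omega>) \<le> u j}"
      using measurable_space[OF T] by auto
    then show ?thesis
      unfolding copula_def space_distr measure_distr[OF T sets_unit_cube_lower_box] by simp
  qed
  then have "has_joint_df K (distr M (unit_cube K) ?T) (copula K M Y)"
    unfolding has_joint_df_def using prob_space_distr[OF T] by simp
  then show "copula_measure K (copula K M Y) = distr M (unit_cube K) ?T"
    and "has_joint_df K (copula_measure K (copula K M Y)) (copula K M Y)"
    by (simp_all add: copula_measure_eqI)
qed

end

theory Submission
  imports Defs "HOL-Real_Asymp.Real_Asymp"
begin

text \<open>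
  A copula only depends on the joint law of the vector, and it does not change when the components
  are transformed in an order-preserving way (\<open>copula_distr\<close>, \<open>copula_cong_order\<close>). Both sides of
  the limit can therefore be brought to the same scale, on which one sees convergence of densities.

  For the sample of size \<open>n\<close> the transformation is \<open>x \<mapsto> n (F x - 1)\<close>. It turns the observations into
  iid uniform variables on \<open>[-n, 0]\<close>, and the \<open>K\<close> largest of those have the density
  \<open>n! / ((n - K)! n\<^sup>K) \<cdot> (1 + w\<^sub>K / n)\<^sup>n\<^sup>-\<^sup>K\<close> on \<open>0 > w\<^sub>1 > \<dots> > w\<^sub>K \<ge> -n\<close>.
  For the MGEV distribution the transformation is \<open>z \<mapsto> - \<Lambda> z\<close>. It is increasing on the domain of
  \<open>\<Lambda>\<close>, and since each factor \<open>- \<Lambda>' (z j)\<close> of the density is the Jacobian of one coordinate, the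
  transformed vector has the density \<open>exp w\<^sub>K\<close> on \<open>0 > w\<^sub>1 > \<dots> > w\<^sub>K\<close> for all \<open>\<mu>\<close>, \<open>\<sigma>\<close>, \<open>\<xi>\<close>
  (\<open>distr_mgev\<close>, \<open>extremal_copula_eq\<close>). This is visibly the pointwise limit of the densities above,
  and for \<open>n \<ge> 2 K\<close> they are dominated by the integrable function \<open>exp (w\<^sub>K / 2)\<close>.

  Dominated convergence gives more than weak convergence of the vectors. It gives
  \<open>G\<^sub>n\<^sub>j x \<longlonglongrightarrow> G\<^sub>j x\<close> for every marginal distribution function and every point \<open>x\<close>. Hence, for a continuous
  \<open>f\<close> on the cube and the densities \<open>h\<^sub>n\<close> above, the integrands
  \<open>f (G\<^sub>n\<^sub>1 w\<^sub>1, \<dots>, G\<^sub>n\<^sub>K w\<^sub>K) h\<^sub>n w\<close> converge pointwise and are dominated too, so that the integrals of \<open>f\<close> against the copulas converge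
  (\<open>copula_conv_of_dominated_densities\<close>).

  The density of the \<open>K\<close> largest values comes from a symmetry argument. Almost surely exactly one of
  the \<open>n!\<close> rearrangements of the sample is decreasing, so the expectation of a function of the
  decreasing rearrangement is \<open>n!\<close> times its expectation over decreasing samples
  (\<open>nn_integral_order_statistics\<close>). The coordinates \<open>n, n - 1, \<dots>, K + 1\<close> are then
  integrated out one at a time (\<open>nn_integral_neg_chain_add\<close>). The same iterated integral shows that
  \<open>exp (a w\<^sub>K)\<close> has finite mass, which is needed for the limit density and for the dominating function.
\<close>

section \<open>Decreasing rearrangements and order statistics\<close>

text \<open>
  Weakly decreasing, so that every vector has a decreasing rearrangement, also one with ties.
\<close>
definition decreasing_upto :: "nat \<Rightarrow> (nat \<Rightarrow> real) \<Rightarrow> bool" where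
  "decreasing_upto n x \<longleftrightarrow> (\<forall>i\<in>{1..n}. \<forall>j\<in>{1..n}. i \<le> j \<longrightarrow> x j \<le> x i)"

text \<open>
  Sorting is determined by the multiset of the entries, so any decreasing rearrangement reads off the
  order statistics. This replaces list manipulations by permutations of the index set, over which one
  can sum and under which product measures are invariant.
\<close>
lemma kth_largest_rearrangement:
  assumes p: "p permutes {1..n}" and d: "decreasing_upto n (x \<circ> p)" and j: "j \<in> {1..n}"
  shows "kth_largest n j x = x (p j)"
proof -
  let ?l = "map (x \<circ> p) [1..<Suc n]"
  have "image_mset p (mset_set {1..n}) = mset_set {1..n}"
    using permutes_inj_on[OF p] permutes_image[OF p] by (simp add: image_mset_mset_set)
  then have "mset ?l = mset (map x [1..<Suc n])"
    unfolding mset_map mset_upt by (metis atLeastLessThanSuc_atLeastAtMost multiset.map_comp)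
  moreover have "sorted (rev ?l)"
    using d
    by (auto simp: sorted_iff_nth_mono rev_nth decreasing_upto_def nth_append simp del: upt_Suc)
  ultimately have "sort (map x [1..<Suc n]) = rev ?l"
    by (intro properties_for_sort) auto
  then show ?thesis
    using j by (auto simp: kth_largest_def nth_append simp del: upt_Suc)
qed

lemma ex_decreasing_rearrangement:
  "\<exists>p. p permutes {1..n} \<and> decreasing_upto n (x \<circ> p)"
proof -
  define l where "l = rev (sort_key x [1..<Suc n])"
  have l: "length l = n" "distinct l" "set l = {1..n}"
    by (auto simp: l_def)
  have s: "sorted (map x (rev l))" by (simp add: l_def)
  define p where "p i = (if i \<in> {1..n} then l ! (i - 1) else i)" for i
  have "bij_betw (\<lambda>i. i - 1) {1..n} {..<n}"
    by (rule bij_betw_byWitness[where f' = Suc]) auto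
  moreover have "bij_betw (\<lambda>i. l ! i) {..<n} {1..n}"
    using l by (intro bij_betw_nth) auto
  ultimately have "bij_betw (\<lambda>i. l ! (i - 1)) {1..n} {1..n}"
    using bij_betw_trans[of "\<lambda>i. i - 1" _ _ "\<lambda>i. l ! i"] by (simp add: o_def)
  then have "bij_betw p {1..n} {1..n}"
    by (rule bij_betw_cong[THEN iffD1, rotated]) (simp add: p_def)
  then have "p permutes {1..n}"
    by (rule bij_imp_permutes) (simp add: p_def del: atLeastAtMost_iff)
  moreover have "decreasing_upto n (x \<circ> p)"
    unfolding decreasing_upto_def
  proof (intro ballI impI)
    fix i j assume ij: "i \<in> {1..n}" "j \<in> {1..n}" "i \<le> j"
    have "map x (rev l) ! (n - j) \<le> map x (rev l) ! (n - i)"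
      using ij l by (intro sorted_nth_mono[OF s]) auto
    then show "(x \<circ> p) j \<le> (x \<circ> p) i"
      using ij l by (simp add: rev_nth p_def)
  qed
  ultimately show ?thesis by blast
qed

lemma kth_largest_mono:
  assumes "mono g" "j \<in> {1..n}"
  shows "kth_largest n j (\<lambda>i. g (x i)) = g (kth_largest n j x)"
proof -
  obtain p where p: "p permutes {1..n}" "decreasing_upto n (x \<circ> p)"
    using ex_decreasing_rearrangement by blast
  then have "decreasing_upto n ((\<lambda>i. g (x i)) \<circ> p)"
    using monoD[OF assms(1)] by (auto simp: decreasing_upto_def)
  then show ?thesis
    using kth_largest_rearrangement p assms(2) by metis
qed

lemma kth_largest_mem:
  assumes "j \<in> {1..n}"
  shows "kth_largest n j x \<in> x ` {1..n}"
proof -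
  obtain p where p: "p permutes {1..n}" "decreasing_upto n (x \<circ> p)"
    using ex_decreasing_rearrangement by blast
  then show ?thesis
    using kth_largest_rearrangement[OF p assms] permutes_in_image[OF p(1), of j] assms by simp
qed

lemma decreasing_upto_measurable:
  "Measurable.pred (PiM {1..n} (\<lambda>_. borel :: real measure)) (decreasing_upto n)"
  unfolding decreasing_upto_def
  by (intro pred_intros_finite pred_intros_imp' borel_measurable_le[unfolded pred_def[symmetric]]
        measurable_component_singleton) simp_all

lemma measurable_permute:
  assumes "p permutes I"
  shows "(\<lambda>x. \<lambda>i\<in>I. x (p i)) \<in> measurable (PiM I (\<lambda>_. N)) (PiM I (\<lambda>_. N))"
  using permutes_in_image[OF assms]
  by (intro measurable_restrict measurable_component_singleton) auto

text \<open>
  The space is covered by the finitely many measurable pieces on which a fixed permutation sorts the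
  vector; on each of them the order statistic is a coordinate.
\<close>
lemma kth_largest_measurable:
  assumes j: "j \<in> {1..n}"
  shows "kth_largest n j \<in> borel_measurable (PiM {1..n} (\<lambda>_. borel))"
proof (rule borel_measurable_iff_le[THEN iffD2], rule allI)
  fix a
  let ?P = "{p. p permutes {1..n}}" and ?N = "PiM {1..n} (\<lambda>_. borel :: real measure)"
  have "{x \<in> space ?N. kth_largest n j x \<le> a} =
      (\<Union>p\<in>?P. {x \<in> space ?N. decreasing_upto n (\<lambda>i\<in>{1..n}. x (p i)) \<and> x (p j) \<le> a})"
    (is "?L = ?R")
  proof -
    have *: "decreasing_upto n (\<lambda>i\<in>{1..n}. x (p i)) \<longleftrightarrow> decreasing_upto n (x \<circ> p)"
        for x :: "nat \<Rightarrow> real" and p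
      by (simp add: decreasing_upto_def)
    show ?thesis
    proof (intro set_eqI iffI)
      fix x assume x: "x \<in> ?L"
      obtain p where p: "p permutes {1..n}" "decreasing_upto n (x \<circ> p)"
        using ex_decreasing_rearrangement by blast
      then show "x \<in> ?R"
        using x kth_largest_rearrangement[OF p j] unfolding * by (intro UN_I[of p]) simp_all
    next
      fix x assume "x \<in> ?R"
      then obtain p where p: "p permutes {1..n}" "decreasing_upto n (x \<circ> p)"
        and "x \<in> space ?N" "x (p j) \<le> a" unfolding * by blast
      then show "x \<in> ?L"
        using kth_largest_rearrangement[OF p j] by simp
    qed
  qed
  also have "\<dots> \<in> sets ?N"
  proof (intro sets.finite_UN)
    fix p assume p: "p \<in> ?P"
    then have "p permutes {1..n}" by simp
    then have 1: "Measurable.pred ?N (\<lambda>x. decreasing_upto n (\<lambda>i\<in>{1..n}. x (p i)))"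
      by (rule measurable_compose[OF measurable_permute decreasing_upto_measurable])
    have "p j \<in> {1..n}"
      using p permutes_in_image[of p "{1..n}" j] j by simp
    then have "(\<lambda>x. x (p j)) \<in> borel_measurable ?N"
      by (rule measurable_component_singleton)
    then have 2: "Measurable.pred ?N (\<lambda>x. x (p j) \<le> a)"
      by simp
    show "{x \<in> space ?N. decreasing_upto n (\<lambda>i\<in>{1..n}. x (p i)) \<and> x (p j) \<le> a} \<in> sets ?N"
      using pred_intros_logic(3)[OF 1 2] by (simp add: pred_def)
  qed (simp add: finite_permutations)
  finally show "?L \<in> sets ?N" .
qed

section \<open>Copulas of random vectors\<close>

lemma (in prob_space) measurable_cdf_distr:
  assumes "Y \<in> borel_measurable M"
  shows "cdf (distr M borel Y) \<in> borel_measurable borel"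
proof -
  interpret D: real_distribution "distr M borel Y"
    using assms by (rule real_distribution_distr)
  show ?thesis
    by (intro borel_measurable_mono monoI D.cdf_nondecreasing)
qed

lemma (in prob_space) measurable_cdf_transform:
  assumes "\<And>j. j \<in> {1..K} \<Longrightarrow> Y j \<in> borel_measurable M"
  shows "(\<lambda>\<omega>. \<lambda>j\<in>{1..K}. cdf (distr M borel (Y j)) (Y j \<omega>)) \<in> measurable M (unit_cube K)"
  unfolding unit_cube_def
proof (rule measurable_restrict)
  fix j assume j: "j \<in> {1..K}"
  interpret D: real_distribution "distr M borel (Y j)"
    using assms[OF j] by (rule real_distribution_distr)
  have "(\<lambda>\<omega>. cdf (distr M borel (Y j)) (Y j \<omega>)) \<in> borel_measurable M"
    using assms[OF j] measurable_cdf_distr[OF assms[OF j]] by (rule measurable_compose)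
  then show "(\<lambda>\<omega>. cdf (distr M borel (Y j)) (Y j \<omega>)) \<in> measurable M (restrict_space borel {0..1})"
    using D.cdf_nonneg D.cdf_bounded_prob by (intro measurable_restrict_space2) auto
qed

text \<open>
  The component of the copula vector that belongs to \<open>Y j\<close> is \<open>\<omega> \<mapsto> P (Y j \<le> Y j \<omega>)\<close>. It only
  uses the comparison of two independent copies of \<open>Y j\<close>, and it suffices that almost all
  comparisons come out alike. This covers transformations such as \<open>F\<close>, which may be constant on
  intervals of probability zero.
\<close>
lemma copula_cong_order:
  assumes "prob_space M"
    and Y: "\<And>j. j \<in> {1..K} \<Longrightarrow> Y j \<in> borel_measurable M"
    and Z: "\<And>j. j \<in> {1..K} \<Longrightarrow> Z j \<in> borel_measurable M"
    and order: "AE \<omega> in M. AE \<omega>' in M. \<forall>j\<in>{1..K}. Y j \<omega>' \<le> Y j \<omega> \<longleftrightarrow> Z j \<omega>' \<le> Z j \<omega>"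
  shows "copula K M Y = copula K M Z"
proof
  fix u
  interpret prob_space M by fact
  have cdf: "cdf (distr M borel V) c = measure M {\<omega> \<in> space M. V \<omega> \<le> c}"
    if "V \<in> borel_measurable M" for V :: "'a \<Rightarrow> real" and c
    using that by (simp add: cdf_def measure_distr vimage_def Int_def conj_commute)
  have eq: "AE \<omega> in M. \<forall>j\<in>{1..K}. cdf (distr M borel (Y j)) (Y j \<omega>)
      = cdf (distr M borel (Z j)) (Z j \<omega>)"
    using order
  proof eventually_elim
    fix \<omega> assume *: "AE \<omega>' in M. \<forall>j\<in>{1..K}. Y j \<omega>' \<le> Y j \<omega> \<longleftrightarrow> Z j \<omega>' \<le> Z j \<omega>"
    show "\<forall>j\<in>{1..K}. cdf (distr M borel (Y j)) (Y j \<omega>) = cdf (distr M borel (Z j)) (Z j \<omega>)"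
    proof
      fix j assume j: "j \<in> {1..K}"
      note [measurable] = Y[OF j] Z[OF j]
      show "cdf (distr M borel (Y j)) (Y j \<omega>) = cdf (distr M borel (Z j)) (Z j \<omega>)"
        unfolding cdf[OF Y[OF j]] cdf[OF Z[OF j]]
        by (rule measure_eq_AE) (use * j in \<open>auto elim!: eventually_mono\<close>)
    qed
  qed
  have meas: "{\<omega> \<in> space M. \<forall>j\<in>{1..K}. cdf (distr M borel (V j)) (V j \<omega>) \<le> u j} \<in> sets M"
    if V: "\<And>j. j \<in> {1..K} \<Longrightarrow> V j \<in> borel_measurable M" for V :: "nat \<Rightarrow> 'a \<Rightarrow> real"
  proof (rule sets.sets_Collect_finite_All)
    fix j assume j: "j \<in> {1..K}"
    have "(\<lambda>\<omega>. cdf (distr M borel (V j)) (V j \<omega>)) \<in> borel_measurable M"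
      using V[OF j] measurable_cdf_distr[OF V[OF j]] by (rule measurable_compose)
    then show "{\<omega> \<in> space M. cdf (distr M borel (V j)) (V j \<omega>) \<le> u j} \<in> sets M"
      by simp
  qed simp
  show "copula K M Y u = copula K M Z u"
    unfolding copula_def
    by (rule measure_eq_AE) (use eq meas[OF Y] meas[OF Z] in \<open>auto elim!: eventually_mono\<close>)
qed

lemma copula_distr:
  assumes "prob_space M"
    and Y: "\<And>j. j \<in> {1..K} \<Longrightarrow> Y j \<in> borel_measurable M"
  shows "copula K M Y
      = copula K (distr M (PiM {1..K} (\<lambda>_. borel)) (\<lambda>\<omega>. \<lambda>j\<in>{1..K}. Y j \<omega>)) (\<lambda>j z. z j)"
proof
  fix u
  interpret prob_space M by fact
  let ?N = "PiM {1..K} (\<lambda>_. borel :: real measure)"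
  let ?D = "distr M ?N (\<lambda>\<omega>. \<lambda>j\<in>{1..K}. Y j \<omega>)"
  have m: "(\<lambda>\<omega>. \<lambda>j\<in>{1..K}. Y j \<omega>) \<in> measurable M ?N"
    using Y by (rule measurable_restrict)
  have d: "distr ?D borel (\<lambda>z. z j) = distr M borel (Y j)" if j: "j \<in> {1..K}" for j
    using j by (subst distr_distr[OF measurable_component_singleton m])
      (auto simp: o_def intro!: distr_cong)
  have B: "{z \<in> space ?N. \<forall>j\<in>{1..K}. cdf (distr M borel (Y j)) (z j) \<le> u j} \<in> sets ?N"
  proof (rule sets.sets_Collect_finite_All)
    fix j assume j: "j \<in> {1..K}"
    have "(\<lambda>z. cdf (distr M borel (Y j)) (z j)) \<in> borel_measurable ?N"
      using measurable_component_singleton[OF j] measurable_cdf_distr[OF Y[OF j]]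
      by (rule measurable_compose)
    then show "{z \<in> space ?N. cdf (distr M borel (Y j)) (z j) \<le> u j} \<in> sets ?N"
      by simp
  qed simp
  have "copula K ?D (\<lambda>j z. z j) u =
      measure ?D {z \<in> space ?N. \<forall>j\<in>{1..K}. cdf (distr M borel (Y j)) (z j) \<le> u j}"
    unfolding copula_def space_distr
    by (intro arg_cong[where f = "measure ?D"] Collect_cong) (metis d)
  also have "\<dots> = measure M {\<omega> \<in> space M. \<forall>j\<in>{1..K}. cdf (distr M borel (Y j)) (Y j \<omega>) \<le> u j}"
    unfolding measure_distr[OF m B] using measurable_space[OF m]
    by (intro arg_cong[where f = "measure M"]) auto
  finally show "copula K M Y u = copula K ?D (\<lambda>j z. z j) u"
    by (simp add: copula_def)
qed

text \<open>
  Points of the cube are \<open>undefined\<close> outside \<open>{1..K}\<close>. As a subspace of the full product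
  \<^typ>\<open>nat \<Rightarrow> real\<close> the cube therefore carries the trace of the countable product \<open>\<sigma>\<close>-algebra,
  which is the Borel \<open>\<sigma>\<close>-algebra of the product topology.
\<close>
lemma borel_measurable_continuous_on_cube:
  fixes f :: "(nat \<Rightarrow> real) \<Rightarrow> real"
  assumes "continuous_on (PiE {1..K} (\<lambda>_. {0..1})) f"
  shows "f \<in> borel_measurable (unit_cube K)"
proof -
  have "(\<lambda>x. x) \<in> measurable (unit_cube K) (PiM UNIV (\<lambda>_. borel))"
  proof (rule measurable_PiM_single')
    fix i :: nat
    show "(\<lambda>x. x i) \<in> borel_measurable (unit_cube K)"
    proof (cases "i \<in> {1..K}")
      case False
      then have "x i = undefined" if "x \<in> space (unit_cube K)" for x
        using that by (auto simp: space_unit_cube PiE_def extensional_def)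
      then show ?thesis
        by (subst measurable_cong[where g = "\<lambda>_. undefined"]) auto
    qed (rule measurable_unit_cube_component)
  qed auto
  then have "(\<lambda>x. x) \<in> measurable (unit_cube K) borel"
    using measurable_cong_sets[OF refl sets_PiM_equal_borel] by blast
  then have "(\<lambda>x. x) \<in> measurable (unit_cube K) (restrict_space borel (PiE {1..K} (\<lambda>_. {0..1})))"
    by (intro measurable_restrict_space2) (auto simp: space_unit_cube)
  then show ?thesis
    using borel_measurable_continuous_on_restrict[OF assms] by (rule measurable_compose)
qed

text \<open>
  Tychonoff, with a one-point factor for each index outside \<open>{1..K}\<close>.
\<close>
lemma compact_cube: "compact (PiE {1..K} (\<lambda>_. {0..1}) :: (nat \<Rightarrow> real) set)"
proof -
  let ?S = "\<lambda>i::nat. if i \<in> {1..K} then {0..1} else {undefined} :: real set"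
  have "(PiE {1..K} (\<lambda>_. {0..1}) :: (nat \<Rightarrow> real) set) = PiE UNIV ?S"
    by (auto simp: PiE_def Pi_def extensional_def split: if_splits)
  moreover have "compactin (product_topology (\<lambda>_. euclidean) UNIV) (PiE UNIV ?S)"
    by (subst compactin_PiE) auto
  ultimately show ?thesis
    by (simp add: euclidean_product_topology flip: compactin_euclidean_iff)
qed

lemma tendsto_coordinatewise:
  fixes x :: "nat \<Rightarrow> 'b \<Rightarrow> real"
  assumes "\<And>i. (\<lambda>n. x n i) \<longlonglongrightarrow> l i"
  shows "x \<longlonglongrightarrow> l"
proof -
  have "limitin (product_topology (\<lambda>_. euclidean) UNIV) x l sequentially"
    using assms by (subst limitin_componentwise) auto
  then show ?thesis by (simp add: euclidean_product_topology)
qed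

section \<open>Convergence of copulas of convergent densities\<close>

text \<open>
  Weak convergence alone would not control the marginal distribution functions at their
  discontinuities. Under domination they converge at every point, because the indicator of
  \<open>{z. z j \<le> x}\<close> is bounded, and then the transformed vectors converge pointwise as well.
\<close>
lemma copula_conv_of_dominated_densities:
  fixes L :: "(nat \<Rightarrow> real) measure" and h :: "nat \<Rightarrow> (nat \<Rightarrow> real) \<Rightarrow> real"
  assumes sets: "sets L = sets (PiM {1..K} (\<lambda>_. borel))"
    and h: "\<And>n. h n \<in> borel_measurable L" "\<And>n x. 0 \<le> h n x"
    and h': "h' \<in> borel_measurable L" "\<And>x. 0 \<le> h' x"
    and prob: "\<And>n. prob_space (density L (\<lambda>x. ennreal (h n x)))"
      "prob_space (density L (\<lambda>x. ennreal (h' x)))"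
    and lim: "AE x in L. (\<lambda>n. h n x) \<longlonglongrightarrow> h' x"
    and dom: "integrable L w" "\<And>n. AE x in L. h n x \<le> w x"
  shows "copula_conv_in_distribution K
      (\<lambda>n. copula K (density L (\<lambda>x. ennreal (h n x))) (\<lambda>j z. z j))
      (copula K (density L (\<lambda>x. ennreal (h' x))) (\<lambda>j z. z j))"
proof -
  define D where "D k = density L (\<lambda>x. ennreal (k x))" for k
  define G where "G k j = cdf (distr (D k) borel (\<lambda>z. z j))" for k j
  have sp: "space L = space (PiM {1..K} (\<lambda>_. borel :: real measure))"
    by (rule sets_eq_imp_space_eq[OF sets])
  have comp [measurable]: "(\<lambda>z. z j) \<in> borel_measurable L" if "j \<in> {1..K}" for j
    using measurable_component_singleton[OF that] measurable_cong_sets[OF sets refl] by blast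
  have compD: "(\<lambda>z. z j) \<in> borel_measurable (D k)" if "j \<in> {1..K}" for j k
    using comp[OF that] by (simp add: D_def)
  have G: "G k j x = (\<integral>z. k z * indicator {z. z j \<le> x} z \<partial>L)" and G01: "G k j x \<in> {0..1}"
    if k: "k \<in> borel_measurable L" "\<And>x. 0 \<le> k x" "prob_space (D k)" and j: "j \<in> {1..K}"
    for k j x
  proof -
    interpret D: prob_space "D k" by fact
    interpret R: real_distribution "distr (D k) borel (\<lambda>z. z j)"
      using compD[OF j] by (rule D.real_distribution_distr)
    show "G k j x \<in> {0..1}"
      using R.cdf_nonneg R.cdf_bounded_prob by (auto simp: G_def)
    note [measurable] = comp[OF j] k(1)
    have "G k j x = measure (D k) {z \<in> space L. z j \<le> x}"
      unfolding G_def cdf_def using compD[OF j]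
      by (subst measure_distr) (auto simp: D_def intro!: arg_cong[where f = "measure _"])
    also have "\<dots> = (\<integral>z. indicator {z \<in> space L. z j \<le> x} z \<partial>D k)"
      by (simp add: D_def)
    also have "\<dots> = (\<integral>z. k z * indicator {z \<in> space L. z j \<le> x} z \<partial>L)"
      unfolding D_def using k by (subst integral_density) auto
    also have "\<dots> = (\<integral>z. k z * indicator {z. z j \<le> x} z \<partial>L)"
      by (intro Bochner_Integration.integral_cong) (auto simp: indicator_def)
    finally show "G k j x = \<dots>" .
  qed
  define T where "T k z = (\<lambda>j\<in>{1..K}. G k j (z j))" for k z
  have T: "T k \<in> measurable L (unit_cube K)" 
    and I: "f \<in> borel_measurable (unit_cube K) \<Longrightarrow>
      integral\<^sup>L (copula_measure K (copula K (D k) (\<lambda>j z. z j))) f = (\<integral>z. k z * f (T k z) \<partial>L)"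
    if k: "k \<in> borel_measurable L" "\<And>x. 0 \<le> k x" "prob_space (D k)"
    for k and f :: "_ \<Rightarrow> real"
  proof -
    interpret D: prob_space "D k" by fact
    have TD: "T k \<in> measurable (D k) (unit_cube K)"
      unfolding T_def[abs_def] G_def by (intro D.measurable_cdf_transform compD)
    then show T: "T k \<in> measurable L (unit_cube K)" by (simp add: D_def)
    have "copula_measure K (copula K (D k) (\<lambda>j z. z j)) = distr (D k) (unit_cube K) (T k)"
      unfolding T_def[abs_def] G_def by (rule copula_measure_copula[OF k(3) compD])
    then show "integral\<^sup>L (copula_measure K (copula K (D k) (\<lambda>j z. z j))) f
        = (\<integral>z. k z * f (T k z) \<partial>L)"
      if f: "f \<in> borel_measurable (unit_cube K)"
      using k measurable_compose[OF T f] by (simp add: integral_distr[OF TD f]) 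
        (simp add: D_def integral_density)
  qed
  have prob': "prob_space (D (h n))" "prob_space (D h')" for n
    using prob by (simp_all add: D_def)
  have G_lim: "(\<lambda>n. G (h n) j x) \<longlonglongrightarrow> G h' j x" if j: "j \<in> {1..K}" for j x
  proof -
    note [measurable] = comp[OF j] h(1) h'(1)
    have [measurable]: "Measurable.pred L (\<lambda>z. z j \<le> x)" by simp
    have "(\<lambda>n. \<integral>z. h n z * indicator {z. z j \<le> x} z \<partial>L) \<longlonglongrightarrow> (\<integral>z. h' z * indicator {z. z j \<le> x} z \<partial>L)"
    proof (rule integral_dominated_convergence[OF _ _ dom(1)])
      show "AE z in L. (\<lambda>n. h n z * indicator {z. z j \<le> x} z) \<longlonglongrightarrow> h' z * indicator {z. z j \<le> x} z"
        using lim by eventually_elim (intro tendsto_intros)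
      show "AE z in L. norm (h n z * indicator {z. z j \<le> x} z) \<le> w z" for n
        using dom(2)[of n] by eventually_elim
          (use h(2)[of n] in \<open>auto simp: indicator_def intro: order_trans\<close>)
    qed (simp_all add: indicator_def)
    then show ?thesis
      by (simp only: G[OF h prob'(1) j] G[OF h' prob'(2) j])
  qed
  have "(\<lambda>n. integral\<^sup>L (copula_measure K (copula K (D (h n)) (\<lambda>j z. z j))) f)
      \<longlonglongrightarrow> integral\<^sup>L (copula_measure K (copula K (D h') (\<lambda>j z. z j))) f"
    if cont: "continuous_on (PiE {1..K} (\<lambda>_. {0..1})) f" for f :: "_ \<Rightarrow> real"
  proof -
    have f: "f \<in> borel_measurable (unit_cube K)"
      by (rule borel_measurable_continuous_on_cube[OF cont])
    have "bounded (f ` (PiE {1..K} (\<lambda>_. {0..1})))"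
      by (intro compact_imp_bounded compact_continuous_image cont compact_cube)
    then obtain B where B: "\<And>x. x \<in> PiE {1..K} (\<lambda>_. {0..1}) \<Longrightarrow> \<bar>f x\<bar> \<le> B" "B > 0"
      unfolding bounded_pos by auto
    have T01: "T k z \<in> PiE {1..K} (\<lambda>_. {0..1})"
      if "k \<in> borel_measurable L" "\<And>x. 0 \<le> k x" "prob_space (D k)" for k z
      using G01[OF that] by (auto simp: T_def)
    have "(\<lambda>n. \<integral>z. h n z * f (T (h n) z) \<partial>L) \<longlonglongrightarrow> (\<integral>z. h' z * f (T h' z) \<partial>L)"
    proof (rule integral_dominated_convergence)
      show "integrable L (\<lambda>z. w z * B)" using dom(1) by simp
      show "(\<lambda>z. h' z * f (T h' z)) \<in> borel_measurable L"
        using h'(1) measurable_compose[OF T[OF h' prob'(2)] f] by (rule borel_measurable_times)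
      show "(\<lambda>z. h n z * f (T (h n) z)) \<in> borel_measurable L" for n
        using h(1) measurable_compose[OF T[OF h prob'(1)] f] by (rule borel_measurable_times)
      show "AE z in L. (\<lambda>n. h n z * f (T (h n) z)) \<longlonglongrightarrow> h' z * f (T h' z)"
        using lim
      proof eventually_elim
        fix z assume "(\<lambda>n. h n z) \<longlonglongrightarrow> h' z"
        moreover have "(\<lambda>n. T (h n) z) \<longlonglongrightarrow> T h' z"
          using G_lim by (intro tendsto_coordinatewise) (auto simp: T_def restrict_def)
        then have "(\<lambda>n. f (T (h n) z)) \<longlonglongrightarrow> f (T h' z)"
          by (rule continuous_on_tendsto_compose[OF cont])
            (intro always_eventually allI T01[OF h prob'(1)] T01[OF h' prob'(2)])+
        ultimately show "(\<lambda>n. h n z * f (T (h n) z)) \<longlonglongrightarrow> h' z * f (T h' z)"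
          by (rule tendsto_mult)
      qed
      show "AE z in L. norm (h n z * f (T (h n) z)) \<le> w z * B" for n
        using dom(2)[of n]
      proof eventually_elim
        fix z assume "h n z \<le> w z"
        moreover have "\<bar>f (T (h n) z)\<bar> \<le> B" by (intro B(1) T01[OF h prob'(1)])
        ultimately show "norm (h n z * f (T (h n) z)) \<le> w z * B"
          using h(2)[of n z] B(2) unfolding real_norm_def abs_mult by (intro mult_mono) auto
      qed
    qed
    then show ?thesis
      by (simp only: I[OF h prob'(1) f] I[OF h' prob'(2) f])
  qed
  then show ?thesis
    unfolding copula_conv_in_distribution_def weak_conv_cube_def D_def by blast
qed

section \<open>Integration over decreasing chains of negative numbers\<close>

text \<open>
  The ordering \<open>0 > w 1 > \<dots> > w m\<close>, in the form that compares neighbours only: appending a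
  coordinate then adds one condition, which makes the coordinates integrable one at a time.
\<close>
definition neg_chain :: "nat \<Rightarrow> (nat \<Rightarrow> real) \<Rightarrow> bool" where
  "neg_chain m w \<longleftrightarrow> (\<forall>i\<in>{1..m}. w i < (if i = 1 then 0 else w (i - 1)))"

text \<open>
  The bound for a coordinate appended to a chain. The value 0 for the empty chain is the upper bound
  of the first coordinate, so that the empty chain needs no separate treatment.
\<close>
definition chain_end :: "nat \<Rightarrow> (nat \<Rightarrow> real) \<Rightarrow> real" where
  "chain_end m w = (if m = 0 then 0 else w m)"

lemma neg_chain_Suc: "neg_chain (Suc m) w \<longleftrightarrow> neg_chain m w \<and> w (Suc m) < chain_end m w"
  by (auto simp: neg_chain_def chain_end_def atLeastAtMostSuc_conv)

lemma neg_chain_iff: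
  "neg_chain m w \<longleftrightarrow> (\<forall>i\<in>{1..m}. w i < 0) \<and> (\<forall>i\<in>{1..m}. \<forall>j\<in>{1..m}. i < j \<longrightarrow> w j < w i)"
proof (induction m)
  case (Suc m)
  show ?case
  proof (cases "m = 0")
    case False
    then have m: "m \<in> {1..m}" by simp
    have *: "(\<forall>i\<in>{1..Suc m}. P i) \<longleftrightarrow> (\<forall>i\<in>{1..m}. P i) \<and> P (Suc m)" for P
      by (simp add: atLeastAtMostSuc_conv conj_commute)
    have "w (Suc m) < w m \<longleftrightarrow> w (Suc m) < 0 \<and> (\<forall>i\<in>{1..m}. w (Suc m) < w i)"
      if R: "\<forall>i\<in>{1..m}. w i < 0" "\<forall>i\<in>{1..m}. \<forall>j\<in>{1..m}. i < j \<longrightarrow> w j < w i"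
    proof (intro iffI conjI ballI)
      assume l: "w (Suc m) < w m"
      then show "w (Suc m) < 0" using R(1) m by (meson less_trans)
      fix i assume i: "i \<in> {1..m}"
      show "w (Suc m) < w i"
        using l R(2)[rule_format, OF i m] i by (cases "i = m") auto
    qed (use m in blast)
    then show ?thesis
      unfolding neg_chain_Suc Suc.IH * chain_end_def using False by fastforce
  qed (auto simp: neg_chain_def)
qed (simp add: neg_chain_def)

lemma chain_end_nonpos: "neg_chain m w \<Longrightarrow> chain_end m w \<le> 0"
  by (auto simp: neg_chain_iff chain_end_def less_imp_le)

lemma neg_chain_cong: "(\<And>i. i \<in> {1..m} \<Longrightarrow> v i = w i) \<Longrightarrow> neg_chain m v \<longleftrightarrow> neg_chain m w"
  by (auto simp: neg_chain_iff)

lemma chain_end_measurable: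
  assumes "\<And>i. i \<in> I \<Longrightarrow> sets (N i) = sets borel" "{1..m} \<subseteq> I"
  shows "chain_end m \<in> borel_measurable (PiM I N)"
proof (cases "m = 0")
  case False
  then have m: "m \<in> I" using assms(2) by auto
  have "(\<lambda>w. w m) \<in> measurable (PiM I N) (N m)" using m by (rule measurable_component_singleton)
  then have "(\<lambda>w. w m) \<in> borel_measurable (PiM I N)"
    using measurable_cong_sets[OF refl assms(1)[OF m]] by blast
  then show ?thesis using False by (simp add: chain_end_def[abs_def])
qed (simp add: chain_end_def[abs_def])

lemma neg_chain_measurable:
  assumes "\<And>i. i \<in> I \<Longrightarrow> sets (N i) = sets borel" "{1..m} \<subseteq> I"
  shows "Measurable.pred (PiM I N) (neg_chain m)"
  using assms(2)
proof (induction m)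
  case (Suc m)
  have "(\<lambda>w. w (Suc m)) \<in> borel_measurable (PiM I N)"
    using chain_end_measurable[OF assms(1) Suc.prems] by (simp add: chain_end_def[abs_def])
  moreover have "chain_end m \<in> borel_measurable (PiM I N)" 
    using Suc.prems by (intro chain_end_measurable assms(1)) auto
  ultimately have 1: "Measurable.pred (PiM I N) (\<lambda>w. w (Suc m) < chain_end m w)" 
    by simp
  have 2: "Measurable.pred (PiM I N) (neg_chain m)"
    by (rule Suc.IH) (use Suc.prems in auto)
  show ?case
    unfolding neg_chain_Suc[abs_def] using 2 1 by (rule pred_intros_logic)
qed (simp add: neg_chain_def[abs_def])

lemma borel_measurable_indicator_neg_chain:
  assumes "\<And>i. i \<in> I \<Longrightarrow> sets (N i) = sets borel" "{1..m} \<subseteq> I"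
  shows "(indicator {w. neg_chain m w} :: _ \<Rightarrow> 'b :: {t1_space, zero_neq_one})
      \<in> borel_measurable (PiM I N)"
  unfolding borel_measurable_indicator_iff
  using neg_chain_measurable[OF assms] by (simp add: pred_def Int_def conj_commute)

lemma nn_integral_neg_chain_Suc:
  fixes \<phi> :: "(nat \<Rightarrow> real) \<Rightarrow> ennreal" and q :: "real \<Rightarrow> ennreal"
  assumes \<phi>: "\<phi> \<in> borel_measurable (PiM {1..m} (\<lambda>_. lborel))"
    and q: "q \<in> borel_measurable borel"
  shows "(\<integral>\<^sup>+w. indicator {w. neg_chain (Suc m) w} w * \<phi> (restrict w {1..m}) * q (chain_end (Suc m) w)
      \<partial>PiM {1..Suc m} (\<lambda>_. lborel)) =
    (\<integral>\<^sup>+w. indicator {w. neg_chain m w} w * \<phi> w *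
      (\<integral>\<^sup>+v. q v * indicator {..<chain_end m w} v \<partial>lborel) \<partial>PiM {1..m} (\<lambda>_. lborel))"
    (is "integral\<^sup>N ?L ?f = _")
proof -
  interpret product_sigma_finite "\<lambda>_::nat. lborel :: real measure" by standard
  have I: "{1..Suc m} = insert (Suc m) {1..m}" by auto
  have L: "?L = PiM (insert (Suc m) {1..m}) (\<lambda>_. lborel)" by (simp only: I)
  have "(\<lambda>w. restrict w {1..m}) \<in> measurable ?L (PiM {1..m} (\<lambda>_. lborel))"
    by (rule measurable_restrict_subset) auto
  then have 1: "(\<lambda>w. \<phi> (restrict w {1..m})) \<in> borel_measurable ?L"
    using \<phi> by (rule measurable_compose)
  have 2: "(\<lambda>w. q (chain_end (Suc m) w)) \<in> borel_measurable ?L"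
    by (rule measurable_compose[OF _ q]) (rule chain_end_measurable, simp_all)
  have 3: "(indicator {w. neg_chain (Suc m) w} :: _ \<Rightarrow> ennreal) \<in> borel_measurable ?L"
    by (rule borel_measurable_indicator_neg_chain) simp_all
  have "?f \<in> borel_measurable ?L"
    by (intro borel_measurable_times_ennreal 1 2 3)
  then have "integral\<^sup>N ?L ?f = (\<integral>\<^sup>+w. (\<integral>\<^sup>+v. ?f (w(Suc m := v)) \<partial>lborel) \<partial>PiM {1..m} (\<lambda>_. lborel))"
    unfolding L by (rule product_nn_integral_insert[rotated 2]) auto
  also have "\<dots> = (\<integral>\<^sup>+w. indicator {w. neg_chain m w} w * \<phi> w *
      (\<integral>\<^sup>+v. q v * indicator {..<chain_end m w} v \<partial>lborel) \<partial>PiM {1..m} (\<lambda>_. lborel))"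
  proof (rule nn_integral_cong)
    fix w assume w: "w \<in> space (PiM {1..m} (\<lambda>_. lborel :: real measure))"
    have "restrict (w(Suc m := v)) {1..m} = w" for v
      using w by (auto simp: space_PiM PiE_def extensional_def)
    moreover have "neg_chain m (w(Suc m := v)) = neg_chain m w" for v
      by (rule neg_chain_cong) auto
    moreover have "chain_end m (w(Suc m := v)) = chain_end m w" for v
      by (simp add: chain_end_def)
    ultimately have "?f (w(Suc m := v)) =
        indicator {w. neg_chain m w} w * \<phi> w * (q v * indicator {..<chain_end m w} v)" for v
      by (simp add: neg_chain_Suc indicator_def) (simp add: chain_end_def)
    then show "(\<integral>\<^sup>+v. ?f (w(Suc m := v)) \<partial>lborel) = indicator {w. neg_chain m w} w * \<phi> w *
      (\<integral>\<^sup>+v. q v * indicator {..<chain_end m w} v \<partial>lborel)"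
      using q by (simp add: nn_integral_cmult)
  qed
  finally show ?thesis .
qed

text \<open>
  Each integration of a last coordinate over the values below its predecessor turns \<open>Q i\<close> into
  \<open>Q (Suc i)\<close>. It applies to functions that depend on the first \<open>K\<close> coordinates and on the smallest
  one.
\<close>
lemma nn_integral_neg_chain_add:
  fixes \<phi> :: "(nat \<Rightarrow> real) \<Rightarrow> ennreal" and Q :: "nat \<Rightarrow> real \<Rightarrow> ennreal"
  assumes \<phi>: "\<phi> \<in> borel_measurable (PiM {1..K} (\<lambda>_. lborel))"
    and Q: "\<And>i. Q i \<in> borel_measurable borel"
    and step: "\<And>i s. s \<le> 0 \<Longrightarrow> (\<integral>\<^sup>+v. Q i v * indicator {..<s} v \<partial>lborel) = Q (Suc i) s"
  shows "(\<integral>\<^sup>+w. indicator {w. neg_chain (K + p) w} w * \<phi> (restrict w {1..K}) * Q i (chain_end (K + p) w)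
      \<partial>PiM {1..K + p} (\<lambda>_. lborel)) =
    (\<integral>\<^sup>+w. indicator {w. neg_chain K w} w * \<phi> w * Q (i + p) (chain_end K w)
      \<partial>PiM {1..K} (\<lambda>_. lborel))"
proof (induction p arbitrary: i)
  case 0
  show ?case
    unfolding add_0_right by (intro nn_integral_cong) (simp add: space_PiM PiE_restrict)
next
  case (Suc p)
  let ?\<psi> = "\<lambda>w. \<phi> (restrict w {1..K})"
  have "(\<lambda>w. restrict w {1..K}) \<in> measurable (PiM {1..K + p} (\<lambda>_. lborel)) (PiM {1..K} (\<lambda>_. lborel))"
    by (rule measurable_restrict_subset) auto
  then have \<psi>: "?\<psi> \<in> borel_measurable (PiM {1..K + p} (\<lambda>_. lborel))"
    using \<phi> by (rule measurable_compose)
  have r: "restrict (restrict w {1..K + p}) {1..K} = restrict w {1..K}" for w :: "nat \<Rightarrow> real"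
    by (auto simp: restrict_def)
  have "(\<integral>\<^sup>+w. indicator {w. neg_chain (K + Suc p) w} w * ?\<psi> w * Q i (chain_end (K + Suc p) w)
      \<partial>PiM {1..K + Suc p} (\<lambda>_. lborel)) =
    (\<integral>\<^sup>+w. indicator {w. neg_chain (K + p) w} w * ?\<psi> w *
      (\<integral>\<^sup>+v. Q i v * indicator {..<chain_end (K + p) w} v \<partial>lborel) \<partial>PiM {1..K + p} (\<lambda>_. lborel))"
    using nn_integral_neg_chain_Suc[OF \<psi> Q] by (simp only: r add_Suc_right)
  also have "\<dots>
      = (\<integral>\<^sup>+w. indicator {w. neg_chain (K + p) w} w * ?\<psi> w * Q (Suc i) (chain_end (K + p) w)
      \<partial>PiM {1..K + p} (\<lambda>_. lborel))"
  proof (rule nn_integral_cong)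
    show "indicator {w. neg_chain (K + p) w} w * ?\<psi> w *
        (\<integral>\<^sup>+v. Q i v * indicator {..<chain_end (K + p) w} v \<partial>lborel) =
      indicator {w. neg_chain (K + p) w} w * ?\<psi> w * Q (Suc i) (chain_end (K + p) w)" for w
      by (cases "neg_chain (K + p) w") 
        (simp_all only: step[OF chain_end_nonpos] indicator_simps mem_Collect_eq mult_zero_left
          not_False_eq_True)
  qed
  also have "\<dots> = (\<integral>\<^sup>+w. indicator {w. neg_chain K w} w * \<phi> w * Q (i + Suc p) (chain_end K w)
      \<partial>PiM {1..K} (\<lambda>_. lborel))"
    using Suc.IH[of "Suc i"] by (simp only: add_Suc add_Suc_right)
  finally show ?case .
qed


text \<open>
  Dividing by \<open>a ^ i\<close> makes \<open>exp (a v)\<close> a family \<open>Q\<close> as in \<open>nn_integral_neg_chain_add\<close>.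
\<close>
lemma nn_integral_exp_below:
  assumes a: "a > (0::real)"
  shows "(\<integral>\<^sup>+v. ennreal (exp (a * v) / a ^ i) * indicator {..<s} v \<partial>lborel)
      = ennreal (exp (a * s) / a ^ Suc i)"
proof -
  have "(\<integral>\<^sup>+v. ennreal (exp (a * v) / a ^ i) * indicator {..<s} v \<partial>lborel) =
      (\<integral>\<^sup>+v. ennreal (exp (a * (s - v)) / a ^ i) * indicator {0<..} v \<partial>lborel)"
    by (subst nn_integral_real_affine[where c = "-1" and t = s])
       (auto intro!: nn_integral_cong simp: indicator_def)
  also have "\<dots> = (\<integral>\<^sup>+v. ennreal (exp (a * (s - v)) / a ^ i) * indicator {0..} v \<partial>lborel)"
    by (intro nn_integral_cong_AE)
        (use AE_lborel_singleton[of "0::real"] in \<open>auto elim!: eventually_mono simp: indicator_def\<close>)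
  also have "\<dots> = ennreal (0 - (- exp (a * (s - 0)) / a ^ Suc i))"
  proof (rule nn_integral_FTC_atLeast)
    show "((\<lambda>v. - exp (a * (s - v)) / a ^ Suc i) has_real_derivative exp (a * (s - x)) / a ^ i) (at x)" for x
      using a by (auto intro!: derivative_eq_intros simp: field_simps)
    have "((\<lambda>v. exp (a * (s - v))) \<longlongrightarrow> 0) at_top"
      using a by real_asymp
    from tendsto_divide[OF tendsto_minus[OF this] tendsto_const, of "a ^ Suc i"] a
    show "((\<lambda>v. - exp (a * (s - v)) / a ^ Suc i) \<longlongrightarrow> 0) at_top"
      by simp
  qed (use a in auto)
  finally show ?thesis by simp
qed

text \<open>
  The family \<open>Q\<close> that belongs to a uniform sample with left end point \<open>a\<close>.
\<close>
lemma nn_integral_power_below: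
  "(\<integral>\<^sup>+v. ennreal (indicator {a..} v * ((v - a) ^ i / fact i)) * indicator {..<s} v \<partial>lborel) =
    ennreal (indicator {a..} s * ((s - a) ^ Suc i / fact (Suc i)))"
proof (cases "a \<le> s")
  case True
  have "(\<integral>\<^sup>+v. ennreal (indicator {a..} v * ((v - a) ^ i / fact i)) * indicator {..<s} v \<partial>lborel) =
      (\<integral>\<^sup>+v. ennreal ((v - a) ^ i / fact i) * indicator {a..s} v \<partial>lborel)"
    by (intro nn_integral_cong_AE)
        (use AE_lborel_singleton[of s] in \<open>auto elim!: eventually_mono simp: indicator_def\<close>)
  also have "\<dots> = ennreal ((s - a) ^ Suc i / fact (Suc i) - (a - a) ^ Suc i / fact (Suc i))"
  proof (rule nn_integral_FTC_Icc)
    fix x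
    have "((\<lambda>v. (v - a) ^ Suc i) has_real_derivative (1 + real i) * ((1 - 0) * (x - a) ^ i)) (at x)"
      by (rule DERIV_power_Suc[OF DERIV_diff[OF DERIV_ident DERIV_const]])
    then have "((\<lambda>v. (v - a) ^ Suc i) has_real_derivative real (Suc i) * (x - a) ^ i) (at x)"
      by (simp only: of_nat_Suc mult_1 diff_0_right)
    from DERIV_cdivide[OF this, of "fact (Suc i)"]
    show "((\<lambda>v. (v - a) ^ Suc i / fact (Suc i)) has_real_derivative (x - a) ^ i / fact i) (at x)"
      by (simp only: fact_Suc mult_divide_mult_cancel_left_if of_nat_eq_0_iff nat.distinct if_False)
  qed (use True in auto)
  finally show ?thesis using True by simp
next
  case False
  then have "(\<integral>\<^sup>+v. ennreal (indicator {a..} v * ((v - a) ^ i / fact i)) * indicator {..<s} v \<partial>lborel) =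
      (\<integral>\<^sup>+v. 0 \<partial>(lborel :: real measure))"
    by (intro nn_integral_cong) (auto simp: indicator_def)
  then show ?thesis using False by simp
qed

text \<open>
  All coordinates are integrated out, down to the empty chain, whose end is 0.
\<close>
lemma nn_integral_neg_chain_exp:
  assumes a: "a > (0::real)"
  shows "(\<integral>\<^sup>+w. indicator {w. neg_chain m w} w * ennreal (exp (a * chain_end m w)) \<partial>PiM {1..m} (\<lambda>_. lborel))
    = ennreal (1 / a ^ m)"
proof -
  interpret product_sigma_finite "\<lambda>_::nat. lborel :: real measure" by standard
  have "(\<integral>\<^sup>+w. indicator {w. neg_chain (0 + m) w} w * 1 * ennreal (exp (a * chain_end (0 + m) w) / a ^ 0)
      \<partial>PiM {1..0 + m} (\<lambda>_. lborel)) =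
    (\<integral>\<^sup>+w. indicator {w. neg_chain 0 w} w * 1 * ennreal (exp (a * chain_end 0 w) / a ^ (0 + m))
      \<partial>PiM {1..0} (\<lambda>_. lborel))"
    by (rule nn_integral_neg_chain_add[where \<phi> = "\<lambda>_. 1" and K = 0 and i = 0 and
          Q = "\<lambda>i v. ennreal (exp (a * v) / a ^ i)"])
       (simp_all only: nn_integral_exp_below[OF a], simp_all)
  also have "\<dots> = ennreal (1 / a ^ m)"
    by (simp add: PiM_empty nn_integral_count_space_finite chain_end_def neg_chain_def)
  finally show ?thesis by simp
qed

section \<open>Order statistics of an iid sample\<close>

lemma PiM_density:
  fixes f :: "real \<Rightarrow> ennreal"
  assumes I: "finite I" and f: "f \<in> borel_measurable borel"
    and fin: "sigma_finite_measure (density lborel f)"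
  shows "PiM I (\<lambda>_. density lborel f) = density (PiM I (\<lambda>_. lborel)) (\<lambda>w. \<Prod>i\<in>I. f (w i))"
proof -
  interpret L: product_sigma_finite "\<lambda>_. lborel :: real measure" by standard
  interpret P: product_sigma_finite "\<lambda>_. density lborel f"
    using fin by (simp add: product_sigma_finite_def)
  let ?D = "density (PiM I (\<lambda>_. lborel)) (\<lambda>w. \<Prod>i\<in>I. f (w i))"
  have comp: "(\<lambda>w. w i) \<in> borel_measurable (PiM I (\<lambda>_. lborel :: real measure))" if "i \<in> I" for i
    using measurable_component_singleton[OF that, of "\<lambda>_. lborel :: real measure"]
    by simp
  have m: "(\<lambda>w. \<Prod>i\<in>I. f (w i)) \<in> borel_measurable (PiM I (\<lambda>_. lborel))"
    by (rule borel_measurable_prod_ennreal) (rule measurable_compose[OF comp f])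
  have "?D = PiM I (\<lambda>_. density lborel f)"
  proof (rule P.PiM_eqI[OF I])
    have "sets (PiM I (\<lambda>_. lborel :: real measure)) = sets (PiM I (\<lambda>_. density lborel f))"
      by (rule sets_PiM_cong) simp_all
    then show "sets ?D = sets (PiM I (\<lambda>_. density lborel f))" by simp
    fix A assume A: "\<And>i. i \<in> I \<Longrightarrow> A i \<in> sets (density lborel f)"
    then have A': "i \<in> I \<Longrightarrow> A i \<in> sets borel" for i by simp
    have "PiE I A \<in> sets (PiM I (\<lambda>_. lborel))"
      using I A' by (intro sets_PiM_I_finite) auto
    then have "emeasure ?D (PiE I A) =
        (\<integral>\<^sup>+w. (\<Prod>i\<in>I. f (w i)) * indicator (PiE I A) w \<partial>PiM I (\<lambda>_. lborel))"
      using m by (simp add: emeasure_density)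
    also have "\<dots> = (\<integral>\<^sup>+w. (\<Prod>i\<in>I. f (w i) * indicator (A i) (w i)) \<partial>PiM I (\<lambda>_. lborel))"
    proof (rule nn_integral_cong)
      fix w assume "w \<in> space (PiM I (\<lambda>_. lborel :: real measure))"
      then have "indicator (PiE I A) w = (\<Prod>i\<in>I. indicator (A i) (w i) :: ennreal)"
        using I by (auto simp: indicator_def space_PiM PiE_iff prod_zero_iff)
      then show "(\<Prod>i\<in>I. f (w i)) * indicator (PiE I A) w = (\<Prod>i\<in>I. f (w i) * indicator (A i) (w i))"
        by (simp add: prod.distrib)
    qed
    also have "\<dots> = (\<Prod>i\<in>I. \<integral>\<^sup>+v. f v * indicator (A i) v \<partial>lborel)"
      using A' f by (intro L.product_nn_integral_prod I) auto
    also have "\<dots> = (\<Prod>i\<in>I. emeasure (density lborel f) (A i))"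
      using A' f by (intro prod.cong) (auto simp: emeasure_density)
    finally show "emeasure ?D (PiE I A) = (\<Prod>i\<in>I. emeasure (density lborel f) (A i))" .
  qed
  then show ?thesis by simp
qed

text \<open>
  By Fubini, as the hyperplane \<open>x i = x j\<close> meets every line in direction \<open>i\<close>
  in a single point, which is a null set.
\<close>
lemma AE_PiM_inj_on:
  fixes \<nu> :: "real measure"
  assumes I: "finite I" and "sigma_finite_measure \<nu>" and sets: "sets \<nu> = sets borel"
    and atom: "\<And>c. emeasure \<nu> {c} = 0"
  shows "AE x in PiM I (\<lambda>_. \<nu>). inj_on x I"
proof -
  interpret product_sigma_finite "\<lambda>_. \<nu>"
    using assms(2) by (simp add: product_sigma_finite_def)
  have ne: "AE x in PiM I (\<lambda>_. \<nu>). x i \<noteq> x j" if ij: "i \<in> I" "j \<in> I" "i \<noteq> j" for i j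
  proof (rule AE_I)
    let ?N = "{x \<in> space (PiM I (\<lambda>_. \<nu>)). x i = x j}"
    show "{x \<in> space (PiM I (\<lambda>_. \<nu>)). \<not> x i \<noteq> x j} \<subseteq> ?N" by auto
    have comp: "(\<lambda>x. x k) \<in> borel_measurable (PiM I (\<lambda>_. \<nu>))" if "k \<in> I" for k
      using measurable_component_singleton[OF that] measurable_cong_sets[OF refl sets] by blast
    show N: "?N \<in> sets (PiM I (\<lambda>_. \<nu>))"
      by (rule borel_measurable_eq[OF comp comp]) fact+
    \<comment> \<open>Coordinate \<open>i\<close> is integrated first, with the others held fixed.\<close>
    have I': "insert i (I - {i}) = I" using ij by auto
    have "emeasure (PiM I (\<lambda>_. \<nu>)) ?N = (\<integral>\<^sup>+x. indicator ?N x \<partial>PiM (insert i (I - {i})) (\<lambda>_. \<nu>))"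
      using nn_integral_indicator[OF N] by (simp only: I')
    also have "\<dots> = (\<integral>\<^sup>+x. (\<integral>\<^sup>+y. indicator ?N (x(i := y)) \<partial>\<nu>) \<partial>PiM (I - {i}) (\<lambda>_. \<nu>))"
    proof (rule product_nn_integral_insert)
      show "indicator ?N \<in> borel_measurable (PiM (insert i (I - {i})) (\<lambda>_. \<nu>))"
        unfolding I' using N by (rule borel_measurable_indicator)
    qed (use I in auto)
    also have "\<dots> = (\<integral>\<^sup>+x. 0 \<partial>PiM (I - {i}) (\<lambda>_. \<nu>))"
    proof (rule nn_integral_cong)
      fix x
      have "(\<integral>\<^sup>+y. indicator ?N (x(i := y)) \<partial>\<nu>) \<le> (\<integral>\<^sup>+y. indicator {x j} y \<partial>\<nu>)"
        using ij by (intro nn_integral_mono) (auto simp: indicator_def)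
      also have "\<dots> = 0" using atom sets by (subst nn_integral_indicator) auto
      finally show "(\<integral>\<^sup>+y. indicator ?N (x(i := y)) \<partial>\<nu>) = 0" by simp
    qed
    finally show "emeasure (PiM I (\<lambda>_. \<nu>)) ?N = 0" by simp
  qed
  have "AE x in PiM I (\<lambda>_. \<nu>). \<forall>i\<in>I. \<forall>j\<in>I. i \<noteq> j \<longrightarrow> x i \<noteq> x j"
  proof (intro AE_finite_allI I)
    fix i j assume "i \<in> I" "j \<in> I"
    then show "AE x in PiM I (\<lambda>_. \<nu>). i \<noteq> j \<longrightarrow> x i \<noteq> x j"
      using ne[of i j] by (cases "i = j") auto
  qed
  then show ?thesis by eventually_elim (auto simp: inj_on_def)
qed

lemma decreasing_upto_if_neg_chain: "neg_chain n x \<Longrightarrow> decreasing_upto n x"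
  by (auto simp: neg_chain_iff decreasing_upto_def le_less)

text \<open>
  Without ties, a decreasing rearrangement is strictly decreasing and the permutation that produces it
  is determined by the order statistics; hence exactly one summand is nonzero.
\<close>
lemma sum_neg_chain_rearrangements:
  fixes \<phi> :: "(nat \<Rightarrow> real) \<Rightarrow> ennreal"
  assumes inj: "inj_on x {1..n}" and neg: "\<And>i. i \<in> {1..n} \<Longrightarrow> x i < 0" and K: "K \<le> n"
  shows "\<phi> (\<lambda>j\<in>{1..K}. kth_largest n j x) =
    (\<Sum>p | p permutes {1..n}. indicator {w. neg_chain n w} (\<lambda>i\<in>{1..n}. x (p i)) *
      \<phi> (restrict (\<lambda>i\<in>{1..n}. x (p i)) {1..K}))"
proof -
  have chain_iff: "neg_chain n (\<lambda>i\<in>{1..n}. x (p i)) \<longleftrightarrow> neg_chain n (x \<circ> p)" for p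
    by (rule neg_chain_cong) auto
  have eq: "kth_largest n j x = x (p j)"
    if "p permutes {1..n}" "neg_chain n (x \<circ> p)" "j \<in> {1..n}" for p j
    using that by (intro kth_largest_rearrangement decreasing_upto_if_neg_chain)
  obtain p where p: "p permutes {1..n}" "decreasing_upto n (x \<circ> p)"
    using ex_decreasing_rearrangement by blast
  have chain_p: "neg_chain n (x \<circ> p)"
    unfolding neg_chain_iff
  proof (intro conjI ballI impI)
    fix i assume i: "i \<in> {1..n}"
    show "(x \<circ> p) i < 0" using neg permutes_in_image[OF p(1), of i] i by simp
    fix j assume j: "j \<in> {1..n}" and ij: "i < j"
    have "(x \<circ> p) j \<le> (x \<circ> p) i" using p(2) i j ij by (auto simp: decreasing_upto_def)
    moreover have "x (p j) \<noteq> x (p i)"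
      using inj_onD[OF inj, of "p j" "p i"] permutes_in_image[OF p(1)] i j ij
        permutes_inj[OF p(1)] by (auto dest: injD)
    ultimately show "(x \<circ> p) j < (x \<circ> p) i" by simp
  qed
  have uniq: "p' = p" if p': "p' permutes {1..n}" "neg_chain n (x \<circ> p')" for p'
  proof
    fix j
    show "p' j = p j"
    proof (cases "j \<in> {1..n}")
      case True
      have "x (p' j) = x (p j)" using eq[OF p' True] eq[OF p(1) chain_p True] by simp
      then show ?thesis
        using inj_onD[OF inj] permutes_in_image[OF p(1), of j] permutes_in_image[OF p'(1), of j] True by simp
    next
      case False
      then show ?thesis using p(1) p'(1) by (simp add: permutes_not_in)
    qed
  qed
  have "(\<Sum>p | p permutes {1..n}. indicator {w. neg_chain n w} (\<lambda>i\<in>{1..n}. x (p i)) *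
      \<phi> (restrict (\<lambda>i\<in>{1..n}. x (p i)) {1..K})) =
    (\<Sum>q\<in>{p}. indicator {w. neg_chain n w} (\<lambda>i\<in>{1..n}. x (q i)) *
      \<phi> (restrict (\<lambda>i\<in>{1..n}. x (q i)) {1..K}))"
  proof (rule sum.mono_neutral_right)
    show "\<forall>q\<in>{p. p permutes {1..n}} - {p}. indicator {w. neg_chain n w} (\<lambda>i\<in>{1..n}. x (q i)) *
        \<phi> (restrict (\<lambda>i\<in>{1..n}. x (q i)) {1..K}) = 0"
    proof
      fix q assume "q \<in> {p. p permutes {1..n}} - {p}"
      then have "\<not> neg_chain n (\<lambda>i\<in>{1..n}. x (q i))" using uniq[of q] chain_iff[of q] by blast
      then show "indicator {w. neg_chain n w} (\<lambda>i\<in>{1..n}. x (q i)) *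
        \<phi> (restrict (\<lambda>i\<in>{1..n}. x (q i)) {1..K}) = 0"
        by (simp only: indicator_simps mem_Collect_eq mult_zero_left not_False_eq_True)
    qed
  qed (use p(1) in \<open>simp_all add: finite_permutations\<close>)
  also have "\<dots> = \<phi> (\<lambda>j\<in>{1..K}. kth_largest n j x)"
  proof -
    have "restrict (\<lambda>i\<in>{1..n}. x (p i)) {1..K} = (\<lambda>j\<in>{1..K}. kth_largest n j x)"
      using K eq[OF p(1) chain_p] by (auto simp: restrict_def fun_eq_iff)
    moreover have "indicator {w. neg_chain n w} (\<lambda>i\<in>{1..n}. x (p i)) = (1 :: ennreal)"
      using chain_p by (simp only: indicator_simps mem_Collect_eq chain_iff)
    moreover have "(\<Sum>q\<in>{p}. g q) = g p" for g :: "(nat \<Rightarrow> nat) \<Rightarrow> ennreal" by simp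
    ultimately show ?thesis by (simp only: mult_1)
  qed
  finally show ?thesis by simp
qed

text \<open>
  Each of the \<open>n!\<close> summands of \<open>sum_neg_chain_rearrangements\<close> has the same integral, because the
  product measure is invariant under permutations of the coordinates.
\<close>
lemma nn_integral_order_statistics:
  fixes \<nu> :: "real measure" and \<phi> :: "(nat \<Rightarrow> real) \<Rightarrow> ennreal"
  assumes \<nu>: "prob_space \<nu>" and sets: "sets \<nu> = sets borel"
    and atom: "\<And>c. emeasure \<nu> {c} = 0" and neg: "AE v in \<nu>. v < 0" and K: "K \<le> n"
    and \<phi>: "\<phi> \<in> borel_measurable (PiM {1..K} (\<lambda>_. borel))"
  shows "(\<integral>\<^sup>+x. \<phi> (\<lambda>j\<in>{1..K}. kth_largest n j x) \<partial>PiM {1..n} (\<lambda>_. \<nu>)) =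
    fact n * (\<integral>\<^sup>+x. indicator {w. neg_chain n w} x * \<phi> (restrict x {1..K}) \<partial>PiM {1..n} (\<lambda>_. \<nu>))"
proof -
  interpret prob_space \<nu> by fact
  let ?P = "PiM {1..n} (\<lambda>_. \<nu>)"
  let ?g = "\<lambda>x. indicator {w. neg_chain n w} x * \<phi> (restrict x {1..K})"
  let ?t = "\<lambda>p x. \<lambda>i\<in>{1..n}. x (p i)"
  have "(\<lambda>w. restrict w {1..K}) \<in> measurable ?P (PiM {1..K} (\<lambda>_. \<nu>))"
    using K by (intro measurable_restrict_subset) auto
  moreover have "\<phi> \<in> borel_measurable (PiM {1..K} (\<lambda>_. \<nu>))"
    using \<phi> measurable_cong_sets[OF sets_PiM_cong[OF refl sets] refl, of "{1..K}"] by blast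
  ultimately have 1: "(\<lambda>w. \<phi> (restrict w {1..K})) \<in> borel_measurable ?P"
    by (rule measurable_compose)
  have "(indicator {w. neg_chain n w} :: _ \<Rightarrow> ennreal) \<in> borel_measurable ?P"
    by (rule borel_measurable_indicator_neg_chain) (simp_all add: sets)
  then have g: "?g \<in> borel_measurable ?P"
    using 1 by (rule borel_measurable_times_ennreal)
  have t: "?t p \<in> measurable ?P ?P" if "p permutes {1..n}" for p
    using that by (rule measurable_permute)
  have d: "distr ?P ?P (?t p) = ?P" if p: "p permutes {1..n}" for p
  proof (rule distr_PiM_reindex)
    show "inj_on p {1..n}" using p by (rule permutes_inj_on)
    show "p \<in> {1..n} \<rightarrow> {1..n}" using permutes_in_image[OF p] by auto
  qed (rule \<nu>)
  have "AE x in ?P. \<forall>i\<in>{1..n}. x i < 0"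
    by (intro AE_finite_allI AE_PiM_component) (use \<nu> neg in auto)
  moreover have "AE x in ?P. inj_on x {1..n}"
    by (rule AE_PiM_inj_on) (use sets atom sigma_finite_measure_axioms in auto)
  ultimately have "AE x in ?P. \<phi> (\<lambda>j\<in>{1..K}. kth_largest n j x)
      = (\<Sum>p | p permutes {1..n}. ?g (?t p x))"
    by eventually_elim (rule sum_neg_chain_rearrangements, use K in auto)
  then have "(\<integral>\<^sup>+x. \<phi> (\<lambda>j\<in>{1..K}. kth_largest n j x) \<partial>?P) =
      (\<integral>\<^sup>+x. (\<Sum>p | p permutes {1..n}. ?g (?t p x)) \<partial>?P)"
    by (rule nn_integral_cong_AE)
  also have "\<dots> = (\<Sum>p | p permutes {1..n}. \<integral>\<^sup>+x. ?g (?t p x) \<partial>?P)"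
    by (rule nn_integral_sum) (use measurable_compose[OF t g] in simp)
  also have "\<dots> = (\<Sum>p | p permutes {1..n}. \<integral>\<^sup>+x. ?g x \<partial>?P)"
  proof (rule sum.cong[OF refl])
    fix p assume "p \<in> {p. p permutes {1..n}}"
    then have p: "p permutes {1..n}" by simp
    show "(\<integral>\<^sup>+x. ?g (?t p x) \<partial>?P) = (\<integral>\<^sup>+x. ?g x \<partial>?P)"
      by (rule nn_integral_distr[OF t[OF p], of ?g, unfolded d[OF p], OF g, symmetric])
  qed
  also have "\<dots> = fact n * (\<integral>\<^sup>+x. ?g x \<partial>?P)"
    by (simp add: card_permutations)
  finally show ?thesis .
qed

section \<open>The largest values of a uniform sample\<close>

definition neg_uniform :: "nat \<Rightarrow> real measure" where
  "neg_uniform n = density lborel (\<lambda>v. ennreal (indicator {- real n..0} v / real n))"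

lemma sets_neg_uniform [simp]: "sets (neg_uniform n) = sets borel"
  by (simp add: neg_uniform_def)

lemma emeasure_neg_uniform:
  assumes "A \<in> sets borel"
  shows "emeasure (neg_uniform n) A = ennreal (1 / real n) * emeasure lborel ({- real n..0} \<inter> A)"
proof -
  have "emeasure (neg_uniform n) A =
      (\<integral>\<^sup>+v. ennreal (indicator {- real n..0} v / real n) * indicator A v \<partial>lborel)"
    unfolding neg_uniform_def using assms by (intro emeasure_density) auto
  also have "\<dots> = (\<integral>\<^sup>+v. ennreal (1 / real n) * indicator ({- real n..0} \<inter> A) v \<partial>lborel)"
    by (intro nn_integral_cong) (auto simp: indicator_def)
  also have "\<dots> = ennreal (1 / real n) * emeasure lborel ({- real n..0} \<inter> A)"
    using assms by (intro nn_integral_cmult_indicator) auto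
  finally show ?thesis .
qed

lemma emeasure_neg_uniform_singleton: "emeasure (neg_uniform n) {c} = 0"
proof -
  have "emeasure lborel ({- real n..0} \<inter> {c}) \<le> emeasure lborel {c}"
    by (intro emeasure_mono) auto
  then show ?thesis by (simp add: emeasure_neg_uniform)
qed

lemma prob_space_neg_uniform: "n > 0 \<Longrightarrow> prob_space (neg_uniform n)"
  by (rule prob_spaceI)
    (simp add: emeasure_neg_uniform sets_eq_imp_space_eq[OF sets_neg_uniform] flip: ennreal_mult)

lemma cdf_neg_uniform:
  assumes "n > 0"
  shows "cdf (neg_uniform n) x = max 0 (min 1 (1 + x / real n))"
proof -
  have "{- real n..0} \<inter> {..x} = {- real n..min 0 x}" by auto
  then have "cdf (neg_uniform n) x
      = enn2real (ennreal (1 / real n) * emeasure lborel {- real n..min 0 x})"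
    by (simp add: cdf_def measure_def emeasure_neg_uniform)
  also have "\<dots> = max 0 (min 1 (1 + x / real n))"
  proof (cases "- real n \<le> min 0 x")
    case True
    then show ?thesis
      using assms by (auto simp: min_def max_def field_simps simp flip: ennreal_mult)
  next
    case False
    then have "{- real n..min 0 x} = {}" and "x < - real n" by auto
    then show ?thesis using assms by (auto simp: field_simps max_def min_def)
  qed
  finally show ?thesis .
qed

text \<open>
  The probability integral transform, shifted and stretched to \<open>[-n, 0]\<close>. For \<open>0 \<le> c < 1\<close> the level
  set \<open>{x. F x \<le> c}\<close> is, if it is nonempty, a closed half-line \<open>{..s}\<close> with \<open>F s = c\<close> by continuity.
\<close>
lemma distr_continuous_cdf_transform:
  assumes M: "prob_space M" and X: "X \<in> borel_measurable M"
    and F: "cdf (distr M borel X) = F" and cont: "continuous_on UNIV F" and n: "n > 0"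
  shows "distr M borel (\<lambda>\<omega>. real n * (F (X \<omega>) - 1)) = neg_uniform n"
proof (rule cdf_unique)
  interpret prob_space M by fact
  interpret D: real_distribution "distr M borel X"
    using X by (rule real_distribution_distr)
  have F_mono: "mono F"
    unfolding F[symmetric] by (intro monoI D.cdf_nondecreasing)
  have F_meas: "F \<in> borel_measurable borel"
    using F_mono by (rule borel_measurable_mono)
  have F01: "0 \<le> F x" "F x \<le> 1" for x
    unfolding F[symmetric] using D.cdf_nonneg D.cdf_bounded_prob by auto
  have F_lim: "(F \<longlongrightarrow> 1) at_top" "(F \<longlongrightarrow> 0) at_bot"
    unfolding F[symmetric] using D.cdf_lim_at_top_prob D.cdf_lim_at_bot by auto
  have FX: "(\<lambda>\<omega>. F (X \<omega>)) \<in> borel_measurable M"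
    using X F_meas by (rule measurable_compose)
  have prob_X: "prob {\<omega> \<in> space M. X \<omega> \<le> x} = F x" for x
    unfolding F[symmetric] cdf_def using X
    by (subst measure_distr) (auto intro!: arg_cong[where f = prob])
  have level: "prob {\<omega> \<in> space M. F (X \<omega>) \<le> c} = c" if c: "0 \<le> c" "c < 1" for c
  proof (cases "\<exists>x. F x \<le> c")
    case False
    then have "prob {\<omega> \<in> space M. F (X \<omega>) \<le> c} = prob {}" by (intro arg_cong[where f = prob]) auto
    moreover have "c \<le> 0"
      using False by (intro tendsto_lowerbound[OF F_lim(2)])
        (auto intro!: always_eventually simp: not_le less_imp_le)
    ultimately show ?thesis using c by simp
  next
    case True
    obtain b where b: "c < F b"
      using order_tendstoD(1)[OF F_lim(1) c(2)] by (auto simp: eventually_at_top_linorder)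
    let ?S = "{x. F x \<le> c}"
    have bdd: "bdd_above ?S"
      using b monoD[OF F_mono]
      by (intro bdd_aboveI[of _ b]) (meson le_cases mem_Collect_eq not_le order_trans)
    have closed: "closed ?S"
      using cont by (intro closed_Collect_le continuous_on_const) simp
    define s where "s = Sup ?S"
    have s: "F s \<le> c"
      using closed_contains_Sup[OF _ bdd closed] True by (auto simp: s_def)
    have above: "c < F x" if "x > s" for x
      using cSup_upper[OF _ bdd, of x] that unfolding s_def[symmetric]
      by (meson mem_Collect_eq not_le)
    have "isCont F s" using cont by (simp add: continuous_on_eq_continuous_at)
    then have "(F \<longlongrightarrow> F s) (at_right s)"
      by (simp add: isCont_def filterlim_at_split)
    then have "c \<le> F s"
      by (rule tendsto_lowerbound)
       
          (use above eventually_at_right_less[of s] in \<open>auto elim!: eventually_mono intro: less_imp_le\<close>)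
    with s have Fs: "F s = c" by simp
    have "F x \<le> c \<longleftrightarrow> x \<le> s" for x
      using above[of x] monoD[OF F_mono, of x s] Fs by fastforce
    then show ?thesis using prob_X[of s] Fs by simp
  qed
  have m: "(\<lambda>\<omega>. real n * (F (X \<omega>) - 1)) \<in> borel_measurable M" using FX by simp
  show "real_distribution (distr M borel (\<lambda>\<omega>. real n * (F (X \<omega>) - 1)))"
    using m by (rule real_distribution_distr)
  show "real_distribution (neg_uniform n)"
    using prob_space_neg_uniform[OF n]
    by (simp add: real_distribution_def real_distribution_axioms_def
      sets_eq_imp_space_eq[OF sets_neg_uniform])
  show "cdf (distr M borel (\<lambda>\<omega>. real n * (F (X \<omega>) - 1))) = cdf (neg_uniform n)"
  proof
    fix x
    have "real n * (f - 1) \<le> x \<longleftrightarrow> f \<le> 1 + x / real n" for f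
      using n by (auto simp: field_simps)
    then have "cdf (distr M borel (\<lambda>\<omega>. real n * (F (X \<omega>) - 1))) x
        = prob {\<omega> \<in> space M. F (X \<omega>) \<le> 1 + x / real n}"
      unfolding cdf_def using m by (subst measure_distr) (auto intro!: arg_cong[where f = prob])
    also have "\<dots> = max 0 (min 1 (1 + x / real n))"
    proof -
      consider "1 + x / real n < 0" | "0 \<le> 1 + x / real n" "1 + x / real n < 1" | "1 \<le> 1 + x / real n"
        by linarith
      then show ?thesis
      proof cases
        case 1
        then have "\<not> F y \<le> 1 + x / real n" for y using F01(1)[of y] by linarith
        then show ?thesis using 1 by simp
      next
        case 2
        then show ?thesis using level by simp
      next
        case 3
        then have "F y \<le> 1 + x / real n" for y using F01(2)[of y] by linarith
        then show ?thesis using 3 by (simp add: prob_space)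
      qed
    qed
    finally show "cdf (distr M borel (\<lambda>\<omega>. real n * (F (X \<omega>) - 1))) x = cdf (neg_uniform n) x"
      by (simp add: cdf_neg_uniform[OF n])
  qed
qed

definition top_density :: "nat \<Rightarrow> nat \<Rightarrow> (nat \<Rightarrow> real) \<Rightarrow> real" where
  "top_density K n w = (if neg_chain K w \<and> - real n \<le> chain_end K w
     then fact n / (fact (n - K) * real n ^ n) * (chain_end K w + real n) ^ (n - K) else 0)"

lemma top_density_nonneg: "0 \<le> top_density K n w"
  by (simp add: top_density_def)

lemma borel_measurable_top_density:
  "top_density K n \<in> borel_measurable (PiM {1..K} (\<lambda>_. lborel))"
proof -
  have 1: "chain_end K \<in> borel_measurable (PiM {1..K} (\<lambda>_. lborel))"
    by (rule chain_end_measurable) simp_all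
  have 2: "Measurable.pred (PiM {1..K} (\<lambda>_. lborel)) (neg_chain K)"
    by (rule neg_chain_measurable) simp_all
  have 3: "Measurable.pred (PiM {1..K} (\<lambda>_. lborel)) (\<lambda>w. - real n \<le> chain_end K w)"
    using 1 by simp
  show ?thesis
    unfolding top_density_def[abs_def] using 1
    by (intro measurable_If pred_intros_logic(3)[OF 2 3, unfolded pred_def]) auto
qed

text \<open>
  A decreasing negative sample has the density \<open>n\<^sup>-\<^sup>n\<close> as long as its smallest value is at least
  \<open>-n\<close>, so that the density depends on the last coordinate alone. Integrating out the \<open>n - K\<close>
  smallest values then leaves \<open>(w\<^sub>K + n) ^ (n - K) / (n - K)!\<close>.
\<close>
lemma distr_top_order_statistics:
  assumes K: "K \<le> n" and n: "n > 0"
  shows "distr (PiM {1..n} (\<lambda>_. neg_uniform n)) (PiM {1..K} (\<lambda>_. borel)) (\<lambda>x. \<lambda>j\<in>{1..K}. kth_largest n j x) =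
    density (PiM {1..K} (\<lambda>_. lborel)) (\<lambda>w. ennreal (top_density K n w))"
    (is "distr ?P ?N ?T = density ?L _")
proof (rule measure_eqI)
  have sets_N: "sets ?L = sets ?N" by (rule sets_PiM_cong) simp_all
  then show "sets (distr ?P ?N ?T) = sets (density ?L (\<lambda>w. ennreal (top_density K n w)))" by simp
  have sets_P: "sets ?P = sets (PiM {1..n} (\<lambda>_. borel :: real measure))"
      by (rule sets_PiM_cong) simp_all
  have T: "?T \<in> measurable ?P ?N"
  proof (rule measurable_restrict)
    fix j assume "j \<in> {1..K}"
    then have "kth_largest n j \<in> borel_measurable (PiM {1..n} (\<lambda>_. borel))"
      using K by (intro kth_largest_measurable) auto
    then show "kth_largest n j \<in> borel_measurable ?P"
      using measurable_cong_sets[OF sets_P refl] by blast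
  qed
  fix A assume "A \<in> sets (distr ?P ?N ?T)"
  then have A: "A \<in> sets ?N" by simp
  define \<phi> :: "(nat \<Rightarrow> real) \<Rightarrow> ennreal" where "\<phi> = indicator A"
  have \<phi>: "\<phi> \<in> borel_measurable ?N" unfolding \<phi>_def using A by (rule borel_measurable_indicator)
  then have \<phi>L: "\<phi> \<in> borel_measurable ?L" using measurable_cong_sets[OF sets_N refl] by blast
  \<comment> \<open>The density \<open>u\<close> of one observation, and the iterated integrals \<open>Q\<close> of \<open>1\<close> from \<open>-n\<close> on.\<close>
  define u where "u v = ennreal (indicator {- real n..0} v / real n)" for v
  define Q where "Q i v = ennreal (indicator {- real n..} v * ((v - - real n) ^ i / fact i))"
      for i v
  define c where "c = ennreal (1 / real n ^ n)"
  let ?Ln = "PiM {1..n} (\<lambda>_. lborel :: real measure)"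
  have nu: "neg_uniform n = density lborel u" by (simp add: neg_uniform_def u_def[abs_def])
  have u: "u \<in> borel_measurable borel" unfolding u_def[abs_def] by simp
  interpret prob_space "neg_uniform n" using n by (rule prob_space_neg_uniform)
  have P: "?P = density ?Ln (\<lambda>w. \<Prod>i\<in>{1..n}. u (w i))"
    unfolding nu by (rule PiM_density) (use u sigma_finite_measure_axioms nu in auto)
  have comp: "(\<lambda>w. w i) \<in> borel_measurable ?Ln" if "i \<in> {1..n}" for i
    using measurable_component_singleton[OF that, of "\<lambda>_. lborel :: real measure"] by simp
  have u_prod: "(\<lambda>w. \<Prod>i\<in>{1..n}. u (w i)) \<in> borel_measurable ?Ln"
    by (rule borel_measurable_prod_ennreal) (rule measurable_compose[OF comp u])
  have "(\<lambda>w. restrict w {1..K}) \<in> measurable ?Ln ?L"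
    using K by (intro measurable_restrict_subset) auto
  then have "(\<lambda>w. \<phi> (restrict w {1..K})) \<in> borel_measurable ?Ln"
    using \<phi>L by (rule measurable_compose)
  moreover have ind: "(indicator {w. neg_chain n w} :: _ \<Rightarrow> ennreal) \<in> borel_measurable ?Ln"
    by (rule borel_measurable_indicator_neg_chain) simp_all
  ultimately have g: "(\<lambda>w. indicator {w. neg_chain n w} w * \<phi> (restrict w {1..K}))
      \<in> borel_measurable ?Ln"
    by (intro borel_measurable_times_ennreal)
  have Q: "Q i \<in> borel_measurable borel" for i unfolding Q_def[abs_def] by simp
  have prod_u: "(\<Prod>i\<in>{1..n}. u (w i)) = c * Q 0 (chain_end n w)" if w: "neg_chain n w" for w
  proof (cases "- real n \<le> chain_end n w")
    case True
    have "- real n \<le> w i \<and> w i \<le> 0" if i: "i \<in> {1..n}" for i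
    proof -
      have "chain_end n w \<le> w i"
        using w i n by (cases "i = n") (auto simp: neg_chain_iff chain_end_def less_imp_le)
      then show ?thesis using w i True by (auto simp: neg_chain_iff less_imp_le)
    qed
    then have "(\<Prod>i\<in>{1..n}. u (w i)) = (\<Prod>i\<in>{1..n}. ennreal (1 / real n))"
      by (intro prod.cong) (auto simp: u_def)
    also have "\<dots> = c * Q 0 (chain_end n w)"
      using True by (simp add: c_def Q_def ennreal_power power_one_over)
    finally show ?thesis .
  next
    case False
    then have "u (w n) = 0" using n by (simp add: u_def chain_end_def)
    then have "(\<Prod>i\<in>{1..n}. u (w i)) = 0"
      using n by (intro prod_zero) auto
    then show ?thesis using False by (simp add: Q_def)
  qed
  have "emeasure (distr ?P ?N ?T) A = (\<integral>\<^sup>+x. \<phi> (?T x) \<partial>?P)"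
    using A nn_integral_distr[OF T, of \<phi>] \<phi> nn_integral_indicator[of A "distr ?P ?N ?T"]
    by (simp only: \<phi>_def sets_distr measurable_distr_eq1)
  also have "\<dots> = fact n * (\<integral>\<^sup>+x. indicator {w. neg_chain n w} x * \<phi> (restrict x {1..K}) \<partial>?P)"
  proof (rule nn_integral_order_statistics)
    show "emeasure (neg_uniform n) {c} = 0" for c
      by (rule emeasure_neg_uniform_singleton)
    show "AE v in neg_uniform n. v < 0"
      unfolding nu using AE_lborel_singleton[of "0::real"] u
      by (subst AE_density) (auto elim!: eventually_mono simp: u_def indicator_def split: if_splits)
  qed (use \<phi> K prob_space_axioms in auto)
  also have "(\<integral>\<^sup>+x. indicator {w. neg_chain n w} x * \<phi> (restrict x {1..K}) \<partial>?P) =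
      (\<integral>\<^sup>+w. (\<Prod>i\<in>{1..n}. u (w i)) * (indicator {w. neg_chain n w} w * \<phi> (restrict w {1..K})) \<partial>?Ln)"
    unfolding P by (rule nn_integral_density[OF u_prod g])
  also have "\<dots>
      = (\<integral>\<^sup>+w. c * (indicator {w. neg_chain n w} w * \<phi> (restrict w {1..K}) * Q 0 (chain_end n w)) \<partial>?Ln)"
  proof (rule nn_integral_cong)
    show "(\<Prod>i\<in>{1..n}. u (w i)) * (indicator {w. neg_chain n w} w * \<phi> (restrict w {1..K})) =
        c * (indicator {w. neg_chain n w} w * \<phi> (restrict w {1..K}) * Q 0 (chain_end n w))" for w
    proof (cases "neg_chain n w")
      case True
      then have "indicator {w. neg_chain n w} w = (1 :: ennreal)" by simp
      then show ?thesis unfolding prod_u[OF True] by (simp only: mult_1 mult_ac)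
    next
      case False
      then have "indicator {w. neg_chain n w} w = (0 :: ennreal)" by simp
      then show ?thesis by (simp only: mult_zero_left mult_zero_right)
    qed
  qed
  also have "\<dots>
      = c * (\<integral>\<^sup>+w. indicator {w. neg_chain n w} w * \<phi> (restrict w {1..K}) * Q 0 (chain_end n w) \<partial>?Ln)"
  proof (rule nn_integral_cmult)
    have "(\<lambda>w. Q 0 (chain_end n w)) \<in> borel_measurable ?Ln"
      by (rule measurable_compose[OF _ Q]) (rule chain_end_measurable, simp_all)
    with g show "(\<lambda>w. indicator {w. neg_chain n w} w * \<phi> (restrict w {1..K}) * Q 0 (chain_end n w))
      \<in> borel_measurable ?Ln"
      by (rule borel_measurable_times_ennreal)
  qed
  also have "(\<integral>\<^sup>+w. indicator {w. neg_chain n w} w * \<phi> (restrict w {1..K}) * Q 0 (chain_end n w) \<partial>?Ln) =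
      (\<integral>\<^sup>+w. indicator {w. neg_chain K w} w * \<phi> w * Q (n - K) (chain_end K w) \<partial>?L)"
  proof -
    have "(\<integral>\<^sup>+v. Q i v * indicator {..<s} v \<partial>lborel) = Q (Suc i) s" for i s
      unfolding Q_def by (rule nn_integral_power_below)
    then show ?thesis
      using nn_integral_neg_chain_add[of \<phi> K Q "n - K" 0, OF \<phi>L Q] K by simp
  qed
  also have "fact n * (c * (\<integral>\<^sup>+w. indicator {w. neg_chain K w} w * \<phi> w * Q (n - K) (chain_end K w) \<partial>?L)) =
      (\<integral>\<^sup>+w. fact n * c * (indicator {w. neg_chain K w} w * \<phi> w * Q (n - K) (chain_end K w)) \<partial>?L)"
  proof (subst nn_integral_cmult)
    have "(\<lambda>w. Q (n - K) (chain_end K w)) \<in> borel_measurable ?L"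
      by (rule measurable_compose[OF _ Q]) (rule chain_end_measurable, simp_all)
    moreover have "(indicator {w. neg_chain K w} :: _ \<Rightarrow> ennreal) \<in> borel_measurable ?L"
      by (rule borel_measurable_indicator_neg_chain) simp_all
    ultimately show "(\<lambda>w. indicator {w. neg_chain K w} w * \<phi> w * Q (n - K) (chain_end K w))
        \<in> borel_measurable ?L"
      using \<phi>L by (intro borel_measurable_times_ennreal)
  qed (simp add: mult.assoc)
  also have "\<dots> = (\<integral>\<^sup>+w. ennreal (top_density K n w) * indicator A w \<partial>?L)"
  proof (rule nn_integral_cong)
    fix w
    have f: "(fact n :: ennreal) = ennreal (fact n)"
      by (metis ennreal_of_nat_eq_real_of_nat of_nat_fact)
    show "fact n * c * (indicator {w. neg_chain K w} w * \<phi> w * Q (n - K) (chain_end K w)) =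
        ennreal (top_density K n w) * indicator A w"
    proof (cases "neg_chain K w \<and> - real n \<le> chain_end K w")
      case True
      then show ?thesis
        unfolding f c_def Q_def top_density_def \<phi>_def
        by (auto simp: indicator_def field_simps simp flip: ennreal_mult)
    next
      case False
      then show ?thesis unfolding Q_def top_density_def by auto
    qed
  qed
  also have "\<dots> = emeasure (density ?L (\<lambda>w. ennreal (top_density K n w))) A"
    using A sets_N borel_measurable_top_density[of K n] by (simp add: emeasure_density)
  finally show "emeasure (distr ?P ?N ?T) A
      = emeasure (density ?L (\<lambda>w. ennreal (top_density K n w))) A" .
qed

section \<open>The copula of the MGEV distribution\<close>

text \<open>
  The density of the MGEV distribution with \<open>\<mu> = -1\<close>, \<open>\<sigma> = 1\<close>, \<open>\<xi> = -1\<close>, for which \<open>\<Lambda> z = -z\<close>.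
\<close>
definition limit_density :: "nat \<Rightarrow> (nat \<Rightarrow> real) \<Rightarrow> real" where
  "limit_density K w = (if neg_chain K w then exp (chain_end K w) else 0)"

lemma limit_density_nonneg: "0 \<le> limit_density K w"
  by (simp add: limit_density_def)

lemma borel_measurable_limit_density:
  assumes "\<And>i. i \<in> {1..K} \<Longrightarrow> sets (N i) = sets borel"
  shows "limit_density K \<in> borel_measurable (PiM {1..K} N)"
proof -
  have 1: "chain_end K \<in> borel_measurable (PiM {1..K} N)"
    by (rule chain_end_measurable) (simp_all add: assms)
  have 2: "Measurable.pred (PiM {1..K} N) (neg_chain K)"
    by (rule neg_chain_measurable) (simp_all add: assms)
  show ?thesis
    unfolding limit_density_def[abs_def] using 1 2
    by (intro measurable_If) (simp_all add: pred_def)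
qed

lemma prob_space_limit_density:
  "prob_space (density (PiM {1..K} (\<lambda>_. lborel)) (\<lambda>w. ennreal (limit_density K w)))"
    (is "prob_space (density ?L _)")
proof (rule prob_spaceI)
  have "emeasure (density ?L (\<lambda>w. ennreal (limit_density K w))) (space ?L) =
      (\<integral>\<^sup>+w. ennreal (limit_density K w) * indicator (space ?L) w \<partial>?L)"
    using borel_measurable_limit_density[of K "\<lambda>_. lborel"] by (intro emeasure_density) auto
  also have "\<dots> = (\<integral>\<^sup>+w. indicator {w. neg_chain K w} w * ennreal (exp (1 * chain_end K w)) \<partial>?L)"
    by (intro nn_integral_cong) (auto simp: limit_density_def indicator_def)
  also have "\<dots> = 1"
    using nn_integral_neg_chain_exp[of 1 K] by simp
  finally show "emeasure (density ?L (\<lambda>w. ennreal (limit_density K w)))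
      (space (density ?L (\<lambda>w. ennreal (limit_density K w)))) = 1" by simp
qed

definition mgev_domain :: "real \<Rightarrow> real \<Rightarrow> real \<Rightarrow> real set" where
  "mgev_domain \<mu> \<sigma> \<xi> = {z. \<xi> * ((z - \<mu>) / \<sigma>) > -1}"

text \<open>
  The function \<open>- \<Lambda>'\<close> on the domain of \<open>\<Lambda>\<close>. Its value 0 elsewhere accounts for the restriction of
  the MGEV density to the domain, one coordinate at a time.
\<close>
definition mgev_slope :: "real \<Rightarrow> real \<Rightarrow> real \<Rightarrow> real \<Rightarrow> real" where
  "mgev_slope \<mu> \<sigma> \<xi> z = (if z \<in> mgev_domain \<mu> \<sigma> \<xi>
     then (if \<xi> = 0 then exp (- ((z - \<mu>) / \<sigma>)) else (1 + \<xi> * ((z - \<mu>) / \<sigma>)) powr (- 1 / \<xi> - 1)) / \<sigma>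
     else 0)"

text \<open>
  Stated for \<open>\<sigma>\<close>-finite factors, as the measure \<open>- \<Lambda>' dz\<close> has infinite mass.
\<close>
lemma distr_PiM_componentwise:
  fixes \<nu> :: "real measure"
  assumes I: "finite I" and \<nu>: "sigma_finite_measure \<nu>" and d: "sigma_finite_measure (distr \<nu> borel g)"
    and g: "g \<in> borel_measurable \<nu>"
  shows "distr (PiM I (\<lambda>_. \<nu>)) (PiM I (\<lambda>_. borel)) (\<lambda>x. \<lambda>i\<in>I. g (x i))
      = PiM I (\<lambda>_. distr \<nu> borel g)"
    (is "distr ?P ?N ?T = _")
proof -
  interpret P: product_sigma_finite "\<lambda>_. \<nu>" using \<nu> by (simp add: product_sigma_finite_def)
  interpret D: product_sigma_finite "\<lambda>_. distr \<nu> borel g" using d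
      by (simp add: product_sigma_finite_def)
  have T: "?T \<in> measurable ?P ?N"
  proof (rule measurable_restrict)
    fix i assume "i \<in> I"
    then have "(\<lambda>x. x i) \<in> measurable ?P \<nu>" by (rule measurable_component_singleton)
    then show "(\<lambda>x. g (x i)) \<in> borel_measurable ?P" using g by (rule measurable_compose)
  qed
  show ?thesis
  proof (rule D.PiM_eqI[OF I])
    have "sets ?N = sets (PiM I (\<lambda>_. distr \<nu> borel g))" by (rule sets_PiM_cong) simp_all
    then show "sets (distr ?P ?N ?T) = sets (PiM I (\<lambda>_. distr \<nu> borel g))" by simp
    fix A assume "\<And>i. i \<in> I \<Longrightarrow> A i \<in> sets (distr \<nu> borel g)"
    then have A: "\<And>i. i \<in> I \<Longrightarrow> A i \<in> sets borel" by simp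
    then have "PiE I A \<in> sets ?N" using I by (intro sets_PiM_I_finite)
    then have "emeasure (distr ?P ?N ?T) (PiE I A) = emeasure ?P (?T -` PiE I A \<inter> space ?P)"
      by (rule emeasure_distr[OF T])
    also have "?T -` PiE I A \<inter> space ?P = PiE I (\<lambda>i. g -` A i \<inter> space \<nu>)"
      by (auto simp: space_PiM PiE_iff)
    also have "emeasure ?P \<dots> = (\<Prod>i\<in>I. emeasure \<nu> (g -` A i \<inter> space \<nu>))"
      using A g by (intro P.emeasure_PiM I) (auto intro: measurable_sets)
    also have "\<dots> = (\<Prod>i\<in>I. emeasure (distr \<nu> borel g) (A i))"
      using A g by (intro prod.cong) (auto simp: emeasure_distr)
    finally show "emeasure (distr ?P ?N ?T) (PiE I A) = (\<Prod>i\<in>I. emeasure (distr \<nu> borel g) (A i))" .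
  qed
qed

lemma sigma_finite_density_lborel:
  assumes "f \<in> borel_measurable borel"
  shows "sigma_finite_measure (density lborel (\<lambda>x. ennreal (f x)))"
  using assms sigma_finite_measure.sigma_finite_iff_density_finite[OF lborel.sigma_finite_measure_axioms,
    of "\<lambda>x. ennreal (f x)"] by simp

locale mgev_parameters =
  fixes \<mu> \<sigma> \<xi> :: real
  assumes \<sigma>: "\<sigma> > 0"
begin

abbreviation "\<Lambda> \<equiv> mgev_Lambda \<mu> \<sigma> \<xi>"
abbreviation "D \<equiv> mgev_domain \<mu> \<sigma> \<xi>"
abbreviation "\<Lambda>' \<equiv> mgev_slope \<mu> \<sigma> \<xi>"

lemma mgev_Lambda_measurable: "\<Lambda> \<in> borel_measurable borel"
  unfolding mgev_Lambda_def[abs_def] by measurable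

lemma mgev_slope_measurable: "\<Lambda>' \<in> borel_measurable borel"
  unfolding mgev_slope_def[abs_def] mgev_domain_def by measurable

lemma mgev_Lambda_pos: "z \<in> D \<Longrightarrow> \<Lambda> z > 0"
  by (auto simp: mgev_Lambda_def mgev_domain_def)

lemma mgev_slope_nonneg: "0 \<le> \<Lambda>' z"
  using \<sigma> by (simp add: mgev_slope_def)

lemma mgev_slope_pos_iff: "0 < \<Lambda>' z \<longleftrightarrow> z \<in> D"
  using \<sigma> by (auto simp: mgev_slope_def mgev_domain_def)

lemma open_mgev_domain: "open D"
  unfolding mgev_domain_def by (intro open_Collect_less continuous_intros) (use \<sigma> in auto)

text \<open>
  The domain is a half-line whose direction depends on the sign of \<open>\<xi>\<close>, or all of \<open>\<real>\<close>.
\<close>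
lemma mgev_domain_between:
  assumes "a \<in> D" "b \<in> D" "a \<le> x" "x \<le> b"
  shows "x \<in> D"
proof (cases "\<xi> \<ge> 0")
  case True
  then have "\<xi> * ((a - \<mu>) / \<sigma>) \<le> \<xi> * ((x - \<mu>) / \<sigma>)"
    using assms \<sigma> by (intro mult_left_mono divide_right_mono) auto
  then show ?thesis using assms by (simp add: mgev_domain_def)
next
  case False
  then have "\<xi> * ((b - \<mu>) / \<sigma>) \<le> \<xi> * ((x - \<mu>) / \<sigma>)"
    using assms \<sigma> by (intro mult_left_mono_neg divide_right_mono) auto
  then show ?thesis using assms by (simp add: mgev_domain_def)
qed

lemma mgev_Lambda_has_derivative:
  assumes "z \<in> D"
  shows "(\<Lambda> has_real_derivative - \<Lambda>' z) (at z)"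
proof (cases "\<xi> = 0")
  case True
  have "((\<lambda>z. exp (- ((z - \<mu>) / \<sigma>))) has_real_derivative - \<Lambda>' z) (at z)"
    using \<sigma> True assms by (auto intro!: derivative_eq_intros simp: mgev_slope_def)
  then show ?thesis using True by (simp add: mgev_Lambda_def[abs_def])
next
  case False
  define a where "a = 1 + \<xi> * ((z - \<mu>) / \<sigma>)"
  have pos: "1 + \<xi> * ((z - \<mu>) / \<sigma>) > 0" using assms by (simp add: mgev_domain_def)
  have "a powr (- 1 / \<xi>) * (0 * ln a + \<xi> / \<sigma> * (- 1 / \<xi>) / a) = - (a powr (- 1 / \<xi> - 1) / \<sigma>)"
    using False \<sigma> pos[folded a_def] by (simp add: powr_diff)
  then have slope: "a powr (- 1 / \<xi>) * (0 * ln a + \<xi> / \<sigma> * (- 1 / \<xi>) / a) = - \<Lambda>' z"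
    using False assms by (simp add: mgev_slope_def a_def)
  have "((\<lambda>z. 1 + \<xi> * ((z - \<mu>) / \<sigma>)) has_real_derivative \<xi> / \<sigma>) (at z)"
    using \<sigma> by (auto intro!: derivative_eq_intros)
  from DERIV_powr[OF this pos DERIV_const[of "- 1 / \<xi>"]]
  have "((\<lambda>z. (1 + \<xi> * ((z - \<mu>) / \<sigma>)) powr (- 1 / \<xi>)) has_real_derivative - \<Lambda>' z) (at z)"
    unfolding slope[unfolded a_def] .
  then show ?thesis
    by (rule has_field_derivative_transform_within_open[OF _ open_mgev_domain assms])
      (use False in \<open>simp add: mgev_Lambda_def mgev_domain_def\<close>)
qed

lemma mgev_Lambda_strict_decreasing:
  assumes "a \<in> D" "b \<in> D"
  shows "\<Lambda> b < \<Lambda> a \<longleftrightarrow> a < b"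
proof -
  have dec: "\<Lambda> y < \<Lambda> x" if "x \<in> D" "y \<in> D" "x < y" for x y
  proof (rule DERIV_neg_imp_decreasing[OF that(3)])
    fix t assume "x \<le> t" "t \<le> y"
    then have "t \<in> D" using that mgev_domain_between by blast
    then show "\<exists>d. (\<Lambda> has_real_derivative d) (at t) \<and> d < 0"
      using mgev_Lambda_has_derivative mgev_slope_pos_iff by (intro exI[of _ "- \<Lambda>' t"]) auto
  qed
  show ?thesis using dec[OF assms] dec[OF assms(2,1)] by (cases a b rule: linorder_cases) auto
qed

lemma mgev_Lambda_surj:
  assumes "t > 0"
  obtains z where "z \<in> D" "\<Lambda> z = t"
proof (cases "\<xi> = 0")
  case True
  then show ?thesis
    using that[of "\<mu> - \<sigma> * ln t"] \<sigma> assms by (simp add: mgev_domain_def mgev_Lambda_def)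
next
  case False
  define z where "z = \<mu> + \<sigma> * ((t powr (- \<xi>) - 1) / \<xi>)"
  have "(z - \<mu>) / \<sigma> = (t powr (- \<xi>) - 1) / \<xi>" using \<sigma> by (simp add: z_def)
  then have z: "\<xi> * ((z - \<mu>) / \<sigma>) = t powr (- \<xi>) - 1" using False by simp
  have p: "t powr (- \<xi>) > 0" using assms by simp
  show ?thesis
  proof (rule that)
    show "z \<in> D" using p unfolding mgev_domain_def mem_Collect_eq z by simp
    have "\<Lambda> z = (t powr (- \<xi>)) powr (- 1 / \<xi>)" using False p unfolding mgev_Lambda_def z by simp
    also have "\<dots> = t" using False assms by (simp add: powr_powr)
    finally show "\<Lambda> z = t" .
  qed
qed

lemma emeasure_mgev_slope_Ioc:
  assumes "a \<in> D" "b \<in> D" "a \<le> b"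
  shows "emeasure (density lborel (\<lambda>z. ennreal (\<Lambda>' z))) {a<..b} = ennreal (\<Lambda> a - \<Lambda> b)"
proof -
  have "emeasure (density lborel (\<lambda>z. ennreal (\<Lambda>' z))) {a<..b} =
      (\<integral>\<^sup>+z. ennreal (\<Lambda>' z) * indicator {a<..b} z \<partial>lborel)"
    using mgev_slope_measurable by (intro emeasure_density) auto
  also have "\<dots> = (\<integral>\<^sup>+z. ennreal (\<Lambda>' z) * indicator {a..b} z \<partial>lborel)"
    by (intro nn_integral_cong_AE)
        (use AE_lborel_singleton[of a] in \<open>auto elim!: eventually_mono simp: indicator_def\<close>)
  also have "\<dots> = ennreal (- \<Lambda> b - (- \<Lambda> a))"
  proof (rule nn_integral_FTC_Icc[OF mgev_slope_measurable])
    fix x assume "x \<in> {a..b}"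
    then have "x \<in> D" using mgev_domain_between[OF assms(1,2), of x] by simp
    from DERIV_minus[OF mgev_Lambda_has_derivative[OF this]]
    show "((\<lambda>z. - \<Lambda> z) has_real_derivative \<Lambda>' x) (at x)" by simp
  qed (rule mgev_slope_nonneg assms(3))+
  finally show ?thesis by (simp add: algebra_simps)
qed

text \<open>
  The change of variables \<open>w = - \<Lambda> z\<close> in one coordinate. The points \<open>z\<close> with \<open>- \<Lambda> z > x\<close> are those
  above the solution of \<open>\<Lambda> z = -x\<close>; exhausting them by bounded intervals, whose ends are solutions
  of \<open>\<Lambda> z = t\<close> with \<open>t\<close> tending to 0, treats the three signs of \<open>\<xi>\<close> alike.
\<close>
lemma distr_mgev_Lambda:
  "distr (density lborel (\<lambda>z. ennreal (\<Lambda>' z))) borel (\<lambda>z. - \<Lambda> z) =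
    density lborel (\<lambda>w. ennreal (indicator {..<0} w))"
    (is "distr ?\<nu> borel ?g = ?R")
proof -
  have g: "?g \<in> borel_measurable ?\<nu>" using mgev_Lambda_measurable by simp
  have R: "emeasure ?R {x<..} = ennreal (- x)" for x
  proof -
    have "emeasure ?R {x<..} = (\<integral>\<^sup>+w. ennreal (indicator {..<0} w) * indicator {x<..} w \<partial>lborel)"
      by (intro emeasure_density) auto
    also have "\<dots> = (\<integral>\<^sup>+w. indicator {x<..<0} w \<partial>lborel)"
      by (intro nn_integral_cong) (auto simp: indicator_def)
    also have "\<dots> = ennreal (- x)" by (cases "x \<le> 0") (auto simp: ennreal_neg)
    finally show ?thesis .
  qed
  have L: "emeasure (distr ?\<nu> borel ?g) {x<..} = ennreal (- x)" for x
  proof -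
    have e: "emeasure (distr ?\<nu> borel ?g) {x<..} = emeasure ?\<nu> (?g -` {x<..})"
      using g by (subst emeasure_distr) auto
    have D_AE: "AE z in ?\<nu>. z \<in> D"
    proof (subst AE_density)
      show "AE z in lborel. 0 < ennreal (\<Lambda>' z) \<longrightarrow> z \<in> D"
        using mgev_slope_pos_iff by auto
    qed (use mgev_slope_measurable in auto)
    have set_g: "?g -` {x<..} \<in> sets ?\<nu>" using measurable_sets[OF g, of "{x<..}"] by simp
    show ?thesis
    proof (cases "x < 0")
      case False
      have "AE z in ?\<nu>. z \<notin> ?g -` {x<..}"
        using D_AE
      proof eventually_elim
        fix z assume "z \<in> D"
        then have "0 < \<Lambda> z" by (rule mgev_Lambda_pos)
        then show "z \<notin> ?g -` {x<..}" using False by simp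
      qed
      then have "emeasure ?\<nu> (?g -` {x<..}) = 0"
        using set_g by (subst (asm) AE_iff_measurable[OF set_g]) auto
      then show ?thesis using e False by (simp add: ennreal_neg)
    next
      case True
      \<comment> \<open>Starts at \<open>t 0 = -x\<close>, so that \<open>\<zeta> 0\<close> is the left end point, and decreases to 0.\<close>
      define t where "t k = - x / real (Suc k)" for k
      have t_pos: "t k > 0" for k using True unfolding t_def by (intro divide_pos_pos) auto
      have "\<exists>z. z \<in> D \<and> \<Lambda> z = t k" for k
        by (rule mgev_Lambda_surj[OF t_pos[of k]]) blast
      then have "\<exists>\<zeta>. \<forall>k. \<zeta> k \<in> D \<and> \<Lambda> (\<zeta> k) = t k"
        by (intro choice) simp
      then obtain \<zeta> where \<zeta>: "\<zeta> k \<in> D" "\<Lambda> (\<zeta> k) = t k" for k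
        by blast
      have \<zeta>_less: "\<zeta> k < \<zeta> l \<longleftrightarrow> t l < t k" for k l
        using mgev_Lambda_strict_decreasing[OF \<zeta>(1) \<zeta>(1)] \<zeta>(2) by metis
      have t_mono: "t l \<le> t k" if "k \<le> l" for k l
        using True that unfolding t_def by (intro divide_left_mono) auto
      have \<zeta>_mono: "\<zeta> k \<le> \<zeta> l" if "k \<le> l" for k l
        using \<zeta>_less[of l k] t_mono[OF that] by linarith
      have t_lim: "t \<longlonglongrightarrow> 0"
        unfolding t_def[abs_def] by (rule LIMSEQ_Suc[OF lim_const_over_n])
      have eq: "emeasure ?\<nu> (?g -` {x<..}) = emeasure ?\<nu> (\<Union>k. {\<zeta> 0<..\<zeta> k})"
      proof (rule emeasure_eq_AE)
        show "AE z in ?\<nu>. z \<in> ?g -` {x<..} \<longleftrightarrow> z \<in> (\<Union>k. {\<zeta> 0<..\<zeta> k})"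
          using D_AE
        proof eventually_elim
          fix z assume z: "z \<in> D"
          have 1: "z \<in> ?g -` {x<..} \<longleftrightarrow> \<zeta> 0 < z"
            using mgev_Lambda_strict_decreasing[OF \<zeta>(1)[of 0] z] \<zeta>(2)[of 0] by (auto simp: t_def)
          obtain k where "t k < \<Lambda> z"
            using order_tendstoD(2)[OF t_lim mgev_Lambda_pos[OF z]]
            by (auto simp: eventually_sequentially)
          then have "z < \<zeta> k"
            using mgev_Lambda_strict_decreasing[OF z \<zeta>(1)[of k]] \<zeta>(2)[of k] by simp
          then show "z \<in> ?g -` {x<..} \<longleftrightarrow> z \<in> (\<Union>k. {\<zeta> 0<..\<zeta> k})"
            unfolding 1 by (auto intro!: exI[of _ k])
        qed
      qed (use set_g in auto)
      have 1: "(\<lambda>k. emeasure ?\<nu> {\<zeta> 0<..\<zeta> k}) \<longlonglongrightarrow> emeasure ?\<nu> (\<Union>k. {\<zeta> 0<..\<zeta> k})"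
        by (rule Lim_emeasure_incseq) (auto simp: incseq_def intro: order_trans[OF _ \<zeta>_mono])
      have 2: "emeasure ?\<nu> {\<zeta> 0<..\<zeta> k} = ennreal (- x - t k)" for k
      proof -
        have "\<Lambda> (\<zeta> 0) - \<Lambda> (\<zeta> k) = - x - t k" by (simp add: \<zeta>(2)) (simp add: t_def)
        then show ?thesis
          using emeasure_mgev_slope_Ioc[OF \<zeta>(1) \<zeta>(1) \<zeta>_mono, of 0 k] by simp
      qed
      have "(\<lambda>k. ennreal (- x - t k)) \<longlonglongrightarrow> ennreal (- x - 0)"
        by (intro tendsto_ennrealI tendsto_intros t_lim)
      then have "emeasure ?\<nu> (\<Union>k. {\<zeta> 0<..\<zeta> k}) = ennreal (- x - 0)"
        by (rule LIMSEQ_unique[OF 1[unfolded 2]])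
      then show ?thesis using e eq by simp
    qed
  qed
  show ?thesis
    by (rule measure_eqI_lessThan) (simp_all add: L R)
qed

text \<open>
  Outside the domain both sides vanish, the right-hand one through a slope. Inside, \<open>- \<Lambda>\<close> is
  increasing and negative, so that the MGEV support is the preimage of the decreasing chains.
\<close>
lemma mgev_density_factorization:
  assumes K: "K \<ge> 1"
  shows "mgev_density K \<mu> \<sigma> \<xi> z =
    (\<Prod>j\<in>{1..K}. \<Lambda>' (z j)) * limit_density K (\<lambda>j\<in>{1..K}. - \<Lambda> (z j))"
proof (cases "\<forall>j\<in>{1..K}. z j \<in> D")
  case False
  then obtain j where j: "j \<in> {1..K}" "z j \<notin> D" by blast
  have "z \<notin> mgev_support K \<mu> \<sigma> \<xi>"
  proof
    assume S: "z \<in> mgev_support K \<mu> \<sigma> \<xi>"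
    have le: "z K \<le> z j" "z j \<le> z 1"
    proof -
      show "z K \<le> z j" using S j(1) by (cases "j = K") (auto simp: mgev_support_def less_imp_le)
      show "z j \<le> z 1" using S j(1) by (cases "j = 1") (auto simp: mgev_support_def less_imp_le)
    qed
    consider "\<xi> = 0" | "\<xi> > 0" | "\<xi> < 0" by linarith
    then have "z j \<in> D"
    proof cases
      case 2
      then have "z j - \<mu> > - \<sigma> / \<xi>" using S le by (auto simp: mgev_support_def)
      then show ?thesis using 2 \<sigma> by (simp add: mgev_domain_def field_simps)
    next
      case 3
      then have "z j - \<mu> < - \<sigma> / \<xi>" using S le by (auto simp: mgev_support_def)
      then show ?thesis using 3 \<sigma> by (simp add: mgev_domain_def field_simps)
    qed (simp add: mgev_domain_def)
    with j(2) show False ..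
  qed
  moreover have "(\<Prod>j\<in>{1..K}. \<Lambda>' (z j)) = 0"
    using j by (intro prod_zero) (auto simp: mgev_slope_def)
  ultimately show ?thesis by (simp add: mgev_density_def)
next
  case True
  have chain: "neg_chain K (\<lambda>j\<in>{1..K}. - \<Lambda> (z j)) \<longleftrightarrow> (\<forall>i\<in>{1..K}. \<forall>j\<in>{1..K}. i < j \<longrightarrow> z i > z j)"
    using True by (auto simp: neg_chain_iff mgev_Lambda_pos mgev_Lambda_strict_decreasing)
  have K': "1 \<in> {1..K}" "K \<in> {1..K}" using K by auto
  have "z K > \<mu> - \<sigma> / \<xi>" if "\<xi> > 0"
    using True K' that \<sigma> by (auto simp: mgev_domain_def field_simps)
  moreover have "\<mu> - \<sigma> / \<xi> > z 1" if "\<xi> < 0"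
    using True K' that \<sigma> by (auto simp: mgev_domain_def field_simps)
  ultimately have supp: "z \<in> mgev_support K \<mu> \<sigma> \<xi> \<longleftrightarrow> neg_chain K (\<lambda>j\<in>{1..K}. - \<Lambda> (z j))"
    unfolding chain by (auto simp: mgev_support_def)
  have "(-1) ^ K * (\<Prod>j\<in>{1..K}. deriv \<Lambda> (z j)) = (\<Prod>j\<in>{1..K}. - deriv \<Lambda> (z j))"
    by (simp add: prod_uminus)
  also have "\<dots> = (\<Prod>j\<in>{1..K}. \<Lambda>' (z j))"
    using True DERIV_imp_deriv[OF mgev_Lambda_has_derivative] by (intro prod.cong) auto
  finally show ?thesis
    using K by (auto simp: mgev_density_def supp limit_density_def chain_end_def mult_ac)
qed

text \<open>
  By the factorization the MGEV distribution has the density \<open>limit_density\<close> in the variables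
  \<open>- \<Lambda> (z j)\<close> with respect to the product of the measures \<open>- \<Lambda>' dz\<close>, and each of these is mapped
  to Lebesgue measure on the negative half-line.
\<close>
lemma distr_mgev:
  assumes K: "K \<ge> 1"
  shows "distr (mgev K \<mu> \<sigma> \<xi>) (PiM {1..K} (\<lambda>_. borel)) (\<lambda>z. \<lambda>j\<in>{1..K}. - \<Lambda> (z j)) =
    density (PiM {1..K} (\<lambda>_. lborel)) (\<lambda>w. ennreal (limit_density K w))" (is ?law)
    and "AE z in mgev K \<mu> \<sigma> \<xi>. \<forall>j\<in>{1..K}. z j \<in> D" (is ?domain)
proof -
  let ?L = "PiM {1..K} (\<lambda>_. lborel :: real measure)" and ?N
      = "PiM {1..K} (\<lambda>_. borel :: real measure)"
  let ?T = "\<lambda>z. \<lambda>j\<in>{1..K}. - \<Lambda> (z j)"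
  define l where "l z = ennreal (\<Lambda>' z)" for z
  define h where "h w = ennreal (limit_density K w)" for w
  let ?\<nu> = "density lborel l"
  have comp: "(\<lambda>w. w i) \<in> borel_measurable ?L" if "i \<in> {1..K}" for i
    using measurable_component_singleton[OF that, of "\<lambda>_. lborel :: real measure"] by simp
  have l: "l \<in> borel_measurable borel" unfolding l_def[abs_def] using mgev_slope_measurable by simp
  have prod_l: "(\<lambda>z. \<Prod>j\<in>{1..K}. l (z j)) \<in> borel_measurable ?L"
    by (rule borel_measurable_prod_ennreal) (rule measurable_compose[OF comp l])
  have T: "?T \<in> measurable ?L ?N"
  proof (rule measurable_restrict)
    fix j assume j: "j \<in> {1..K}"
    have "(\<lambda>z. - \<Lambda> z) \<in> borel_measurable borel" using mgev_Lambda_measurable by simp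
    with comp[OF j] show "(\<lambda>z. - \<Lambda> (z j)) \<in> borel_measurable ?L"
      by (rule measurable_compose)
  qed
  have h: "h \<in> borel_measurable ?N" "h \<in> borel_measurable ?L"
    unfolding h_def[abs_def] using borel_measurable_limit_density[of K "\<lambda>_. borel"]
      borel_measurable_limit_density[of K "\<lambda>_. lborel"] by simp_all
  have hT: "(\<lambda>z. h (?T z)) \<in> borel_measurable ?L" using T h(1) by (rule measurable_compose)
  have "ennreal (mgev_density K \<mu> \<sigma> \<xi> z) = (\<Prod>j\<in>{1..K}. l (z j)) * h (?T z)" for z
    unfolding mgev_density_factorization[OF K] l_def h_def
    by (simp add: ennreal_mult' prod_nonneg mgev_slope_nonneg prod_ennreal)
  then have mgev: "mgev K \<mu> \<sigma> \<xi> = density ?L (\<lambda>z. (\<Prod>j\<in>{1..K}. l (z j)) * h (?T z))"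
    unfolding mgev_def by presburger
  have \<nu>: "sigma_finite_measure ?\<nu>"
    unfolding l_def[abs_def] by (rule sigma_finite_density_lborel[OF mgev_slope_measurable])
  have mgev': "mgev K \<mu> \<sigma> \<xi> = density (PiM {1..K} (\<lambda>_. ?\<nu>)) (\<lambda>z. h (?T z))"
    unfolding mgev PiM_density[OF finite_atLeastAtMost l \<nu>]
    using prod_l hT by (rule density_density_eq[symmetric])
  define r where "r w = ennreal (indicator {..<0::real} w)" for w
  have r: "r \<in> borel_measurable borel" unfolding r_def[abs_def] by simp
  have \<nu>_distr: "distr ?\<nu> borel (\<lambda>z. - \<Lambda> z) = density lborel r"
    unfolding l_def[abs_def] r_def[abs_def] by (rule distr_mgev_Lambda)
  have r_fin: "sigma_finite_measure (density lborel r)"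
    unfolding r_def[abs_def] by (rule sigma_finite_density_lborel) simp
  have T\<nu>: "?T \<in> measurable (PiM {1..K} (\<lambda>_. ?\<nu>)) ?N"
    using T unfolding PiM_density[OF finite_atLeastAtMost l \<nu>] by simp
  have "distr (PiM {1..K} (\<lambda>_. ?\<nu>)) ?N ?T = PiM {1..K} (\<lambda>_. density lborel r)"
    unfolding \<nu>_distr[symmetric]
    by (rule distr_PiM_componentwise)
        (use \<nu> r_fin mgev_Lambda_measurable in \<open>simp_all add: \<nu>_distr\<close>)
  also have "\<dots> = density ?L (\<lambda>w. \<Prod>i\<in>{1..K}. r (w i))"
    by (rule PiM_density[OF finite_atLeastAtMost r r_fin])
  finally have Lr: "distr (PiM {1..K} (\<lambda>_. ?\<nu>)) ?N ?T = density ?L (\<lambda>w. \<Prod>i\<in>{1..K}. r (w i))" .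
  have "distr (mgev K \<mu> \<sigma> \<xi>) ?N ?T = density (distr (PiM {1..K} (\<lambda>_. ?\<nu>)) ?N ?T) h"
    unfolding mgev' using h(1) T\<nu> by (rule density_distr[symmetric])
  also have "\<dots> = density ?L (\<lambda>w. (\<Prod>i\<in>{1..K}. r (w i)) * h w)"
    unfolding Lr
    by (rule density_density_eq[OF borel_measurable_prod_ennreal h(2)])
      (rule measurable_compose[OF comp r])
  also have "(\<lambda>w. (\<Prod>i\<in>{1..K}. r (w i)) * h w) = h"
  proof
    fix w
    show "(\<Prod>i\<in>{1..K}. r (w i)) * h w = h w"
    proof (cases "neg_chain K w")
      case True
      then have "(\<Prod>i\<in>{1..K}. r (w i)) = 1" by (intro prod.neutral) (auto simp: neg_chain_iff r_def)
      then show ?thesis by simp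
    qed (simp add: h_def limit_density_def)
  qed
  finally show ?law unfolding h_def .
  show ?domain
    unfolding mgev
  proof (subst AE_density)
    show "(\<lambda>z. (\<Prod>j\<in>{1..K}. l (z j)) * h (?T z)) \<in> borel_measurable ?L"
      using prod_l hT by (rule borel_measurable_times_ennreal)
    have "z j \<in> D" if "0 < (\<Prod>j\<in>{1..K}. l (z j)) * h (?T z)" "j \<in> {1..K}" for z j
    proof -
      have "(\<Prod>j\<in>{1..K}. l (z j)) \<noteq> 0" using that(1) by (metis less_irrefl mult_zero_left)
      then have "l (z j) \<noteq> 0" using that(2) by (auto simp: prod_zero_iff)
      then show ?thesis by (cases "z j \<in> D") (simp_all add: l_def mgev_slope_def)
    qed
    then show "AE z in ?L. 0 < (\<Prod>j\<in>{1..K}. l (z j)) * h (?T z) \<longrightarrow> (\<forall>j\<in>{1..K}. z j \<in> D)"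
      by (intro AE_I2) blast
  qed
qed

lemma extremal_copula_eq:
  assumes K: "K \<ge> 1"
  shows "extremal_copula K \<mu> \<sigma> \<xi> =
    copula K (density (PiM {1..K} (\<lambda>_. lborel)) (\<lambda>w. ennreal (limit_density K w))) (\<lambda>j z. z j)"
proof -
  let ?M = "mgev K \<mu> \<sigma> \<xi>"
  have comp: "(\<lambda>z. z j) \<in> borel_measurable ?M" if "j \<in> {1..K}" for j
    using measurable_component_singleton[OF that, of "\<lambda>_. lborel :: real measure"]
    by (simp add: mgev_def)
  have Z: "(\<lambda>z. - \<Lambda> (z j)) \<in> borel_measurable ?M" if "j \<in> {1..K}" for j
  proof -
    have "(\<lambda>z. - \<Lambda> z) \<in> borel_measurable borel" using mgev_Lambda_measurable by simp
    then show ?thesis by (rule measurable_compose[OF comp[OF that]])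
  qed
  have T: "(\<lambda>z. \<lambda>j\<in>{1..K}. - \<Lambda> (z j)) \<in> measurable ?M (PiM {1..K} (\<lambda>_. borel))"
    using Z by (rule measurable_restrict)
  have prob: "prob_space ?M"
    by (rule prob_space_distrD[OF T]) (simp only: distr_mgev(1)[OF K] prob_space_limit_density)
  have "copula K ?M (\<lambda>j z. z j) = copula K ?M (\<lambda>j z. - \<Lambda> (z j))"
  proof (rule copula_cong_order[OF prob comp Z])
    show "AE z in ?M. AE z' in ?M. \<forall>j\<in>{1..K}. z' j \<le> z j \<longleftrightarrow> - \<Lambda> (z' j) \<le> - \<Lambda> (z j)"
      using distr_mgev(2)[OF K]
    proof eventually_elim
      fix z assume z: "\<forall>j\<in>{1..K}. z j \<in> D"
      show "AE z' in ?M. \<forall>j\<in>{1..K}. z' j \<le> z j \<longleftrightarrow> - \<Lambda> (z' j) \<le> - \<Lambda> (z j)"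
        using distr_mgev(2)[OF K]
      proof eventually_elim
        fix z' assume z': "\<forall>j\<in>{1..K}. z' j \<in> D"
        show "\<forall>j\<in>{1..K}. z' j \<le> z j \<longleftrightarrow> - \<Lambda> (z' j) \<le> - \<Lambda> (z j)"
        proof
          fix j assume j: "j \<in> {1..K}"
          then show "z' j \<le> z j \<longleftrightarrow> - \<Lambda> (z' j) \<le> - \<Lambda> (z j)"
            using mgev_Lambda_strict_decreasing[of "z j" "z' j"] z z'
            by (simp add: not_less[symmetric])
        qed
      qed
    qed
  qed
  also have "\<dots>
      = copula K (distr ?M (PiM {1..K} (\<lambda>_. borel)) (\<lambda>z. \<lambda>j\<in>{1..K}. - \<Lambda> (z j))) (\<lambda>j z. z j)"
    by (rule copula_distr[OF prob Z])
  finally show ?thesis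
    unfolding distr_mgev(1)[OF K] extremal_copula_def .
qed

end

section \<open>Asymptotics of the density of the largest values\<close>

lemma falling_factorial_ratio_Suc:
  assumes "K < n"
  shows "(fact n :: real) / (fact (n - Suc K) * real n ^ Suc K) =
    fact n / (fact (n - K) * real n ^ K) * (1 - real K / real n)"
proof -
  define d where "d = real (n - K)"
  have "n - K = Suc (n - Suc K)" using assms by simp
  then have "(fact (n - K) :: real) = d * fact (n - Suc K)" unfolding d_def by (simp only: fact_Suc)
  moreover have "1 - real K / real n = d / real n"
    using assms by (simp add: d_def of_nat_diff field_simps)
  moreover have "d \<noteq> 0" using assms by (simp add: d_def)
  ultimately show ?thesis by (simp add: mult_ac)
qed

lemma falling_factorial_ratio_le_1:
  "K \<le> n \<Longrightarrow> (fact n :: real) / (fact (n - K) * real n ^ K) \<le> 1"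
proof (induction K)
  case (Suc K)
  then have "fact n / (fact (n - K) * real n ^ K) * (1 - real K / real n) \<le> 1 * (1 :: real)"
    by (intro mult_mono) (auto simp: field_simps)
  then show ?case using Suc.prems by (simp add: falling_factorial_ratio_Suc del: power_Suc)
qed simp

lemma falling_factorial_ratio_tendsto:
  "(\<lambda>n. (fact n :: real) / (fact (n - K) * real n ^ K)) \<longlonglongrightarrow> 1"
proof (induction K)
  case (Suc K)
  have "(\<lambda>n. fact n / (fact (n - K) * real n ^ K) * (1 - real K / real n)) \<longlonglongrightarrow> 1 * (1 - 0 :: real)"
    by (intro tendsto_intros Suc.IH lim_const_over_n)
  moreover have "\<forall>\<^sub>F n in sequentially. fact n / (fact (n - K) * real n ^ K) * (1 - real K / real n) =
      (fact n :: real) / (fact (n - Suc K) * real n ^ Suc K)"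
    using eventually_gt_at_top[of K] by eventually_elim (rule falling_factorial_ratio_Suc[symmetric])
  ultimately have "(\<lambda>n. (fact n :: real) / (fact (n - Suc K) * real n ^ Suc K)) \<longlonglongrightarrow> 1 * (1 - 0)"
    by (rule Lim_transform_eventually)
  then show ?case by (simp only: mult_1 diff_0_right)
qed simp

lemma top_density_rescaled:
  assumes "K \<le> n" "n > 0" "neg_chain K w" "- real n \<le> chain_end K w"
  shows "top_density K n w =
    fact n / (fact (n - K) * real n ^ K) * (1 + chain_end K w / real n) ^ (n - K)"
proof -
  have "real n ^ n = real n ^ K * real n ^ (n - K)"
    using assms(1) by (simp flip: power_add)
  moreover have "1 + chain_end K w / real n = (chain_end K w + real n) / real n"
    using assms(2) by (simp add: field_simps)
  ultimately show ?thesis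
    using assms by (simp add: top_density_def power_divide)
qed

lemma top_density_tendsto: "(\<lambda>n. top_density K n w) \<longlonglongrightarrow> limit_density K w"
proof (cases "neg_chain K w")
  case True
  let ?x = "chain_end K w"
  have pos: "\<forall>\<^sub>F n in sequentially. 0 < 1 + ?x / real n"
  proof -
    have "(\<lambda>n. 1 + ?x / real n) \<longlonglongrightarrow> 1 + 0" by (intro tendsto_intros lim_const_over_n)
    then show ?thesis by (rule order_tendstoD) simp
  qed
  have "(\<lambda>n. fact n / (fact (n - K) * real n ^ K) * ((1 + ?x / real n) ^ n / (1 + ?x / real n) ^ K))
      \<longlonglongrightarrow> 1 * (exp ?x / (1 + 0) ^ K)"
    by (intro tendsto_intros falling_factorial_ratio_tendsto
      tendsto_exp_limit_sequentially lim_const_over_n) simp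
  moreover have "\<forall>\<^sub>F n in sequentially.
      fact n / (fact (n - K) * real n ^ K) * ((1 + ?x / real n) ^ n / (1 + ?x / real n) ^ K)
          = top_density K n w"
    using pos eventually_gt_at_top[of 0] eventually_ge_at_top[of K]
  proof eventually_elim
    fix n :: nat assume n: "0 < 1 + ?x / real n" "0 < n" "K \<le> n"
    have "- real n \<le> ?x" using n(1,2) by (simp add: field_simps)
    moreover have "(1 + ?x / real n) ^ n / (1 + ?x / real n) ^ K = (1 + ?x / real n) ^ (n - K)"
      using n by (simp add: power_diff)
    ultimately show "fact n / (fact (n - K) * real n ^ K) * ((1 + ?x / real n) ^ n / (1 + ?x / real n) ^ K)
      = top_density K n w"
      using n True by (simp add: top_density_rescaled)
  qed
  ultimately have "(\<lambda>n. top_density K n w) \<longlonglongrightarrow> 1 * (exp ?x / (1 + 0) ^ K)"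
    by (rule Lim_transform_eventually)
  then show ?thesis using True by (simp add: limit_density_def)
next
  case False
  then show ?thesis by (simp add: top_density_def limit_density_def)
qed

text \<open>
  By \<open>1 + t \<le> exp t\<close>, and because \<open>(n - K) / n \<ge> 1 / 2\<close> as soon as \<open>n \<ge> 2 K\<close>; note that
  \<open>chain_end K w\<close> is nonpositive.
\<close>
lemma top_density_le:
  assumes n: "2 * K \<le> n" "0 < n"
  shows "top_density K n w \<le> (if neg_chain K w then exp (1 / 2 * chain_end K w) else 0)"
proof (cases "neg_chain K w \<and> - real n \<le> chain_end K w")
  case True
  let ?x = "chain_end K w"
  have x: "?x \<le> 0" using True by (simp add: chain_end_nonpos)
  have base: "0 \<le> 1 + ?x / real n" using True n by (simp add: field_simps)
  have "(1 + ?x / real n) ^ (n - K) \<le> exp (?x / real n) ^ (n - K)"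
    using base by (intro power_mono) (rule exp_ge_add_one_self)
  also have "\<dots> = exp (real (n - K) / real n * ?x)"
    by (simp add: exp_of_nat_mult[symmetric])
  also have "\<dots> \<le> exp (1 / 2 * ?x)"
  proof -
    have "1 / 2 \<le> real (n - K) / real n" using n by (simp add: field_simps of_nat_diff)
    then show ?thesis using x by (simp only: exp_le_cancel_iff mult_right_mono_neg)
  qed
  finally have p: "(1 + ?x / real n) ^ (n - K) \<le> exp (1 / 2 * ?x)" .
  have "top_density K n w =
      fact n / (fact (n - K) * real n ^ K) * (1 + chain_end K w / real n) ^ (n - K)"
    using True n by (intro top_density_rescaled) auto
  also have "\<dots> \<le> 1 * exp (1 / 2 * ?x)"
    using n base p falling_factorial_ratio_le_1[of K n] by (intro mult_mono) auto
  finally have "top_density K n w \<le> exp (1 / 2 * ?x)" by simp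
  then show ?thesis using True by simp
next
  case False
  then show ?thesis by (auto simp: top_density_def)
qed

lemma integrable_dominating_density:
  "integrable (PiM {1..K} (\<lambda>_. lborel)) (\<lambda>w.
      if neg_chain K w then exp (1 / 2 * chain_end K w) else 0)"
    (is "integrable ?L ?g")
proof (rule integrableI_bounded)
  have 1: "chain_end K \<in> borel_measurable ?L"
    by (rule chain_end_measurable) simp_all
  have 2: "Measurable.pred ?L (neg_chain K)"
    by (rule neg_chain_measurable) simp_all
  show "?g \<in> borel_measurable ?L"
    using 1 2 by (intro measurable_If) (simp_all add: pred_def)
  have "(\<integral>\<^sup>+w. ennreal (norm (?g w)) \<partial>?L) =
      (\<integral>\<^sup>+w. indicator {w. neg_chain K w} w * ennreal (exp (1 / 2 * chain_end K w)) \<partial>?L)"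
    by (intro nn_integral_cong) (auto simp: indicator_def)
  also have "\<dots> = ennreal (1 / (1 / 2) ^ K)"
    by (rule nn_integral_neg_chain_exp) simp
  finally show "(\<integral>\<^sup>+w. ennreal (norm (?g w)) \<partial>?L) < \<infinity>" by simp
qed

text \<open>
  The map \<open>g x = n (F x - 1)\<close> commutes with taking order statistics, but it may identify different
  values. It does not change comparisons almost surely, since the transformed sample has no atoms:
  for fixed \<open>\<omega>\<close>, almost no \<open>\<omega>'\<close> gives the same transformed order statistic.
\<close>
lemma copula_top_order_statistics:
  fixes X :: "nat \<Rightarrow> 'a \<Rightarrow> real" and F :: "real \<Rightarrow> real"
  assumes K: "K \<le> n" and n: "n > 0" and M: "prob_space M"
    and indep: "prob_space.indep_vars M (\<lambda>_. borel) X {1..n}"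
    and F: "\<And>i. i \<in> {1..n} \<Longrightarrow> cdf (distr M borel (X i)) = F"
    and cont: "continuous_on UNIV F"
  shows "copula K M (\<lambda>j \<omega>. kth_largest n j (\<lambda>i. X i \<omega>)) =
      copula K (density (PiM {1..K} (\<lambda>_. lborel)) (\<lambda>w. ennreal (top_density K n w))) (\<lambda>j z. z j)"
    and "prob_space (density (PiM {1..K} (\<lambda>_. lborel)) (\<lambda>w. ennreal (top_density K n w)))"
proof -
  interpret prob_space M by fact
  define g where "g x = real n * (F x - 1)" for x
  let ?Y = "\<lambda>j \<omega>. kth_largest n j (\<lambda>i. X i \<omega>)" and ?Z = "\<lambda>j \<omega>. kth_largest n j (\<lambda>i. g (X i \<omega>))"
  let ?Pn = "PiM {1..n} (\<lambda>_. borel :: real measure)" and ?N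
      = "PiM {1..K} (\<lambda>_. borel :: real measure)"
  have X: "X i \<in> borel_measurable M" if "i \<in> {1..n}" for i
    using indep that by (auto simp: indep_vars_def)
  have F_mono: "mono F"
  proof -
    have 1: "1 \<in> {1..n}" using n by simp
    interpret D: real_distribution "distr M borel (X 1)" using X[OF 1]
        by (rule real_distribution_distr)
    show ?thesis unfolding F[OF 1, symmetric] by (intro monoI D.cdf_nondecreasing)
  qed
  have g_mono: "mono g"
    unfolding g_def using monoD[OF F_mono] by (intro monoI mult_left_mono) auto
  have g: "g \<in> borel_measurable borel" using g_mono by (rule borel_measurable_mono)
  have W: "(\<lambda>\<omega>. g (X i \<omega>)) \<in> borel_measurable M" if "i \<in> {1..n}" for i
    using X[OF that] g by (rule measurable_compose)
  have W_distr: "distr M borel (\<lambda>\<omega>. g (X i \<omega>)) = neg_uniform n" if i: "i \<in> {1..n}" for i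
    unfolding g_def by (rule distr_continuous_cdf_transform[OF M X[OF i] F[OF i] cont n])
  have W_indep: "indep_vars (\<lambda>_. borel) (\<lambda>i \<omega>. g (X i \<omega>)) {1..n}"
    using indep g by (rule indep_vars_compose2)
  have kth: "(\<lambda>\<omega>. kth_largest n j (\<lambda>i. V i \<omega>)) \<in> borel_measurable M"
    if V: "\<And>i. i \<in> {1..n} \<Longrightarrow> V i \<in> borel_measurable M" and j: "j \<in> {1..K}"
        for V :: "nat \<Rightarrow> 'a \<Rightarrow> real" and j
  proof -
    have "(\<lambda>\<omega>. \<lambda>i\<in>{1..n}. V i \<omega>) \<in> measurable M ?Pn" using V by (rule measurable_restrict)
    moreover have "kth_largest n j \<in> borel_measurable ?Pn"
      using j K by (intro kth_largest_measurable) auto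
    ultimately have "(\<lambda>\<omega>. kth_largest n j (\<lambda>i\<in>{1..n}. V i \<omega>)) \<in> borel_measurable M"
      by (rule measurable_compose)
    moreover have "kth_largest n j (\<lambda>i\<in>{1..n}. V i \<omega>) = kth_largest n j (\<lambda>i. V i \<omega>)" for \<omega>
      unfolding kth_largest_def
      by (intro arg_cong[where f = "\<lambda>l. rev (sort l) ! (j - 1)"] map_cong) auto
    ultimately show ?thesis by simp
  qed
  have Zg: "?Z j \<omega> = g (?Y j \<omega>)" if "j \<in> {1..K}" for j \<omega>
    using that K by (intro kth_largest_mono[OF g_mono]) auto
  have no_atom: "AE \<omega> in M. ?Z j \<omega> \<noteq> c" if j: "j \<in> {1..K}" for j c
  proof -
    have "AE \<omega> in M. g (X i \<omega>) \<noteq> c" if i: "i \<in> {1..n}" for i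
    proof -
      have "AE v in distr M borel (\<lambda>\<omega>. g (X i \<omega>)). v \<noteq> c"
        unfolding W_distr[OF i]
        by (intro AE_I[of _ _ "{c}"]) (auto simp: emeasure_neg_uniform_singleton)
      then show ?thesis using W[OF i] by (simp add: AE_distr_iff)
    qed
    then have "AE \<omega> in M. \<forall>i\<in>{1..n}. g (X i \<omega>) \<noteq> c"
      by (intro AE_finite_allI) auto
    then show ?thesis
    proof eventually_elim
      fix \<omega> assume *: "\<forall>i\<in>{1..n}. g (X i \<omega>) \<noteq> c"
      have "?Z j \<omega> \<in> (\<lambda>i. g (X i \<omega>)) ` {1..n}" using j K by (intro kth_largest_mem) auto
      then show "?Z j \<omega> \<noteq> c" using * by auto
    qed
  qed
  have "copula K M ?Y = copula K M ?Z"
  proof (rule copula_cong_order[OF M])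
    show "?Y j \<in> borel_measurable M" if "j \<in> {1..K}" for j using X that by (rule kth)
    show "?Z j \<in> borel_measurable M" if "j \<in> {1..K}" for j using W that by (rule kth)
    show "AE \<omega> in M. AE \<omega>' in M. \<forall>j\<in>{1..K}. ?Y j \<omega>' \<le> ?Y j \<omega> \<longleftrightarrow> ?Z j \<omega>' \<le> ?Z j \<omega>"
    proof (rule AE_I2)
      fix \<omega>
      have "AE \<omega>' in M. \<forall>j\<in>{1..K}. ?Z j \<omega>' \<noteq> ?Z j \<omega>"
        by (intro AE_finite_allI no_atom) auto
      then show "AE \<omega>' in M. \<forall>j\<in>{1..K}. ?Y j \<omega>' \<le> ?Y j \<omega> \<longleftrightarrow> ?Z j \<omega>' \<le> ?Z j \<omega>"
      proof eventually_elim
        fix \<omega>' assume ne: "\<forall>j\<in>{1..K}. ?Z j \<omega>' \<noteq> ?Z j \<omega>"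
        show "\<forall>j\<in>{1..K}. ?Y j \<omega>' \<le> ?Y j \<omega> \<longleftrightarrow> ?Z j \<omega>' \<le> ?Z j \<omega>"
        proof
          fix j assume j: "j \<in> {1..K}"
          have "g (?Y j \<omega>') \<noteq> g (?Y j \<omega>)" using ne j Zg[OF j] by metis
          then show "?Y j \<omega>' \<le> ?Y j \<omega> \<longleftrightarrow> ?Z j \<omega>' \<le> ?Z j \<omega>"
            unfolding Zg[OF j] using monoD[OF g_mono] by (meson antisym linear)
        qed
      qed
    qed
  qed
  also have "\<dots> = copula K (distr M ?N (\<lambda>\<omega>. \<lambda>j\<in>{1..K}. ?Z j \<omega>)) (\<lambda>j z. z j)"
    by (rule copula_distr[OF M kth[OF W]])
  also have law: "distr M ?N (\<lambda>\<omega>. \<lambda>j\<in>{1..K}. ?Z j \<omega>) =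
      density (PiM {1..K} (\<lambda>_. lborel)) (\<lambda>w. ennreal (top_density K n w))"
  proof -
    let ?W = "\<lambda>\<omega>. \<lambda>i\<in>{1..n}. g (X i \<omega>)" and ?T = "\<lambda>x. \<lambda>j\<in>{1..K}. kth_largest n j x"
    have W_meas: "?W \<in> measurable M ?Pn" using W by (rule measurable_restrict)
    have T: "?T \<in> measurable ?Pn ?N"
      using K by (intro measurable_restrict kth_largest_measurable) auto
    have "{1..n} \<noteq> {}" using n by simp
    then have "distr M ?Pn ?W = (PiM {1..n} (\<lambda>i. distr M borel (\<lambda>\<omega>. g (X i \<omega>))))"
      using W_indep by (subst (asm) indep_vars_iff_distr_eq_PiM'[OF _ W]) auto
    also have "\<dots> = PiM {1..n} (\<lambda>_. neg_uniform n)"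
      by (rule PiM_cong) (use W_distr in auto)
    finally have W_law: "distr M ?Pn ?W = PiM {1..n} (\<lambda>_. neg_uniform n)" .
    have "?T (?W \<omega>) = (\<lambda>j\<in>{1..K}. ?Z j \<omega>)" for \<omega>
      unfolding kth_largest_def
      by (intro restrict_ext arg_cong[where f = "\<lambda>l. rev (sort l) ! (_ - 1)"] map_cong) auto
    then have "distr M ?N (\<lambda>\<omega>. \<lambda>j\<in>{1..K}. ?Z j \<omega>) = distr (distr M ?Pn ?W) ?N ?T"
      unfolding distr_distr[OF T W_meas] o_def by (simp only:)
    then show ?thesis
      unfolding W_law distr_top_order_statistics[OF K n] .
  qed
  finally show "copula K M ?Y =
      copula K (density (PiM {1..K} (\<lambda>_. lborel)) (\<lambda>w. ennreal (top_density K n w))) (\<lambda>j z. z j)" .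
  have "(\<lambda>\<omega>. \<lambda>j\<in>{1..K}. ?Z j \<omega>) \<in> measurable M ?N"
    by (rule measurable_restrict) (rule kth[OF W])
  then show "prob_space (density (PiM {1..K} (\<lambda>_. lborel)) (\<lambda>w. ennreal (top_density K n w)))"
    unfolding law[symmetric] by (rule prob_space_distr)
qed

section \<open>Convergence to the extremal copula\<close>

theorem proposition2p4:
  fixes K :: nat
    and M :: "nat \<Rightarrow> 'a measure"
    and X :: "nat \<Rightarrow> nat \<Rightarrow> 'a \<Rightarrow> real"
    and F :: "nat \<Rightarrow> real \<Rightarrow> real"
    and \<mu> \<sigma> \<xi> :: real
  assumes "K \<ge> 2"
    and "\<And>n. n \<ge> K \<Longrightarrow> prob_space (M n)"
    and "\<And>n. n \<ge> K \<Longrightarrow> prob_space.indep_vars (M n) (\<lambda>_. borel) (X n) {1..n}"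
    and "\<And>n i. n \<ge> K \<Longrightarrow> i \<in> {1..n} \<Longrightarrow> cdf (distr (M n) borel (X n i)) = F n"
    and "\<And>n. n \<ge> K \<Longrightarrow> continuous_on UNIV (F n)"
    and "\<sigma> > 0"
  shows "copula_conv_in_distribution K
           (\<lambda>n. copula K (M n) (\<lambda>j \<omega>. kth_largest n j (\<lambda>i. X n i \<omega>)))
           (extremal_copula K \<mu> \<sigma> \<xi>)"
proof -
  interpret mgev_parameters \<mu> \<sigma> \<xi> using assms(6) by unfold_locales
  let ?L = "PiM {1..K} (\<lambda>_. lborel :: real measure)"
  let ?C = "\<lambda>n. copula K (M n) (\<lambda>j \<omega>. kth_largest n j (\<lambda>i. X n i \<omega>))"
  let ?P = "\<lambda>n. density ?L (\<lambda>w. ennreal (top_density K n w))"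
  \<comment> \<open>The domination by \<open>exp (w\<^sub>K / 2)\<close> starts at \<open>n = 2 K\<close>.\<close>
  define N where "N = 2 * K"
  have N: "K \<le> n + N" "0 < n + N" "2 * K \<le> n + N" for n using assms(1) by (auto simp: N_def)
  have C: "?C (n + N) = copula K (?P (n + N)) (\<lambda>j z. z j)" for n
    by (rule copula_top_order_statistics(1)[OF N(1,2) assms(2,3,4,5)[OF N(1)]])
  have P: "prob_space (?P (n + N))" for n
    by (rule copula_top_order_statistics(2)[OF N(1,2) assms(2,3,4,5)[OF N(1)]])
  have "copula_conv_in_distribution K (\<lambda>n. copula K (?P (n + N)) (\<lambda>j z. z j))
      (copula K (density ?L (\<lambda>w. ennreal (limit_density K w))) (\<lambda>j z. z j))"
  proof (rule copula_conv_of_dominated_densities)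
    show "sets ?L = sets (PiM {1..K} (\<lambda>_. borel))" by (rule sets_PiM_cong) simp_all
    show "AE w in ?L. (\<lambda>n. top_density K (n + N) w) \<longlonglongrightarrow> limit_density K w"
      using LIMSEQ_ignore_initial_segment[OF top_density_tendsto] by simp
    show "AE w in ?L. top_density K (n + N) w \<le>
      (if neg_chain K w then exp (1 / 2 * chain_end K w) else 0)" for n
      using top_density_le[OF N(3,2)] by simp
  qed (use borel_measurable_top_density top_density_nonneg limit_density_nonneg P
      borel_measurable_limit_density prob_space_limit_density integrable_dominating_density in auto)
  then have "weak_conv_cube K (\<lambda>n. copula_measure K (?C (n + N)))
    (copula_measure K (extremal_copula K \<mu> \<sigma> \<xi>))"
    using assms(1) by (simp add: copula_conv_in_distribution_def C extremal_copula_eq)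
  then show ?thesis
    unfolding copula_conv_in_distribution_def weak_conv_cube_def
    by (blast intro: LIMSEQ_offset)
qed

end
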